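(* Let $\kappa$ be a Mahlo cardinal, or more generally a strongly inaccessible cardinal such that $S^\kappa_{\mathrm{pr}}$ is stationary in $\kappa$. Then (1) $\mathrm{add}(\mathrm{id}^-(\mathbb Q_\kappa),\mathrm{id}(\mathbb Q_\kappa))\le\mathrm{add}(\mathbf{nst}^{\mathrm{pr}}_\kappa)$, and (2) $\mathrm{cf}(\mathrm{id}^-(\mathbb Q_\kappa),\mathrm{id}(\mathbb Q_\kappa))\ge\mathrm{cf}(\mathbf{nst}^{\mathrm{pr}}_\kappa)$.
   Context: For a cardinal $\lambda$, $S^\lambda_{\mathrm{inc}}$ is the set of strongly inaccessible cardinals below $\lambda$. A set $S\subseteq\lambda$ is nowhere stationary if for every $\delta\le\lambda$ of uncountable cofinality, $S\cap\delta$ is nonstationary in $\delta$. By induction on strongly inaccessible $\lambda$ one defines a forcing $\mathbb Q_\lambda$ and an ideal $\mathrm{id}(\mathbb Q_\lambda)$ on $2^\lambda$: $p\in\mathbb Q_\lambda$ iff $p\subseteq 2^{<\lambda}$ is closed under initial segments and there is a witness $(\tau,S,\langle N_\delta:\delta\in S\rangle)$ with: (i) $\tau$ is the trunk of $p$, the least node of $p$ having two immediate successors in $p$; (ii) if $\tau\trianglelefteq\eta\in p$ then $\eta^\frown0,\eta^\frown1\in p$; (iii) $S\subseteq S^\lambda_{\mathrm{inc}}$ is nowhere stationary; (iv) $N_\delta\in\mathrm{id}(\mathbb Q_\delta)$ for $\delta\in S$; (v) for limit $\delta<\lambda$ with $\delta\notin S$ and $\eta\in2^\delta$: $\eta\in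 p$ iff $\eta\restriction\sigma\in p$ for all $\sigma<\delta$; (vi) for $\delta\in S$ and $\eta\in 2^\delta$: $\eta\in p$ iff $\eta\restriction\sigma\in p$ for all $\sigma<\delta$ and $\eta\notin N_\delta$. The order is $q\le p$ iff $q\subseteq p$. $[p]$ is the set of $x\in 2^\lambda$ all of whose proper initial segments lie in $p$; for $\mathcal J\subseteq\mathbb Q_\lambda$, $\mathrm{set}_0(\mathcal J)=2^\lambda\setminus\bigcup_{p\in\mathcal J}[p]$. $A\in\mathrm{id}(\mathbb Q_\lambda)$ iff there are at most $\lambda$ predense sets $\mathcal J_i\subseteq\mathbb Q_\lambda$ with $A\subseteq\bigcup_i\mathrm{set}_0(\mathcal J_i)$. $\mathrm{id}^-(\mathbb Q_\kappa)$ is the family of $A\subseteq 2^\kappa$ for which there are a nowhere stationary $S\subseteq S^\kappa_{\mathrm{inc}}$ and sets $N_\delta\in\mathrm{id}(\mathbb Q_\delta)$ ($\delta\in S$) with $A\subseteq\{\eta\in2^\kappa:\{\delta\in S:\eta\restriction\delta\in N_\delta\}\text{ is unbounded in }\kappa\}$. $\Pr(\lambda)$ means: there is a family $\{\Lambda_i:i<\lambda\}$ of maximal antichains of $\mathbb Q_\lambda$ such that no $p\in\mathbb Q_\lambda$ satisfies $[p]\subseteq\bigcap_{i<\lambda}\bigcup_{q\in\Lambda_i}[q]$; $S^\kappa_{\mathrm{pr}}=\{\lambda\in S^\kappa_{\mathrm{inc}}:\Pr(\lambda)\}$. $\mathbf{nst}^{\mathrm{pr}}_\kappa$ is the family of nowhere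 stationary subsets of $S^\kappa_{\mathrm{pr}}$, ordered by $\subseteq^*$ ($A\subseteq^*B$ iff $A\setminus B$ is bounded in $\kappa$); $\mathrm{add}(\mathbf{nst}^{\mathrm{pr}}_\kappa)$ is the least size of a subfamily with no $\subseteq^*$-upper bound in $\mathbf{nst}^{\mathrm{pr}}_\kappa$, and $\mathrm{cf}(\mathbf{nst}^{\mathrm{pr}}_\kappa)$ is the least size of a subfamily $\mathcal C$ such that every member of $\mathbf{nst}^{\mathrm{pr}}_\kappa$ is $\subseteq^*$ some member of $\mathcal C$. For ideals $\mathbf i\subseteq\mathbf j$ on a set: $\mathrm{add}(\mathbf i,\mathbf j)=\min\{|\mathcal A|:\mathcal A\subseteq\mathbf i,\ \bigcup\mathcal A\notin\mathbf j\}$ and $\mathrm{cf}(\mathbf i,\mathbf j)=\min\{|\mathcal A|:\mathcal A\subseteq\mathbf j,\ (\forall B\in\mathbf i)(\exists A\in\mathcal A)\,B\subseteq A\}$. *)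

theory Defs
  imports Main "HOL-Library.Countable_Set"
begin

text \<open>Ordinals are modelled as elements of an arbitrary well-ordered type 'o;
  the ordinal alpha is identified with its initial segment {beta. beta < alpha}.
  An element of 2^delta is a function 'o => bool that is False from delta on;
  a node of 2^{<lambda} is a pair (alpha, f) with alpha < lambda and f in 2^alpha.\<close>

definition ordset :: "'o::wellorder \<Rightarrow> 'o set" where
  "ordset a = {b. b < a}"

definition seqs :: "'o::wellorder \<Rightarrow> ('o \<Rightarrow> bool) set" where
  "seqs d = {f. \<forall>b. d \<le> b \<longrightarrow> \<not> f b}"

definition rstr :: "('o::wellorder \<Rightarrow> bool) \<Rightarrow> 'o \<Rightarrow> ('o \<Rightarrow> bool)" where
  "rstr f s = (\<lambda>b. if b < s then f b else False)"

definition nodes :: "'o::wellorder \<Rightarrow> ('o \<times> ('o \<Rightarrow> bool)) set" where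
  "nodes l = {(a, f). a < l \<and> f \<in> seqs a}"

definition initseg :: "('o::wellorder \<times> ('o \<Rightarrow> bool)) \<Rightarrow> ('o \<times> ('o \<Rightarrow> bool)) \<Rightarrow> bool" where
  "initseg nu eta \<longleftrightarrow> fst nu \<le> fst eta \<and> snd nu = rstr (snd eta) (fst nu)"

definition osucc :: "'o::wellorder \<Rightarrow> 'o" where
  "osucc a = (LEAST b. a < b)"

definition ext :: "('o::wellorder \<times> ('o \<Rightarrow> bool)) \<Rightarrow> bool \<Rightarrow> ('o \<times> ('o \<Rightarrow> bool))" where
  "ext eta i = (osucc (fst eta), (snd eta)(fst eta := i))"

definition unbounded_in :: "'o::wellorder \<Rightarrow> 'o set \<Rightarrow> bool" where
  "unbounded_in d X \<longleftrightarrow> (\<forall>b<d. \<exists>c\<in>X. b \<le> c)"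

definition bounded_in :: "'o::wellorder \<Rightarrow> 'o set \<Rightarrow> bool" where
  "bounded_in d X \<longleftrightarrow> (\<exists>b<d. \<forall>c\<in>X. c < b)"

definition limit_ord :: "'o::wellorder \<Rightarrow> bool" where
  "limit_ord d \<longleftrightarrow> (\<exists>b. b < d) \<and> (\<forall>b<d. \<exists>c. b < c \<and> c < d)"

definition uncountable_cof :: "'o::wellorder \<Rightarrow> bool" where
  "uncountable_cof d \<longleftrightarrow> \<not> (\<exists>C \<subseteq> ordset d. countable C \<and> unbounded_in d C)"

definition club_in :: "'o::wellorder \<Rightarrow> 'o set \<Rightarrow> bool" where
  "club_in d C \<longleftrightarrow> C \<subseteq> ordset d \<and> unbounded_in d C \<and>
     (\<forall>g<d. limit_ord g \<and> unbounded_in g (C \<inter> ordset g) \<longrightarrow> g \<in> C)"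

definition stationary_in :: "'o::wellorder \<Rightarrow> 'o set \<Rightarrow> bool" where
  "stationary_in d S \<longleftrightarrow> S \<subseteq> ordset d \<and> (\<forall>C. club_in d C \<longrightarrow> S \<inter> C \<noteq> {})"

definition nowhere_stationary :: "'o::wellorder \<Rightarrow> 'o set \<Rightarrow> bool" where
  "nowhere_stationary l S \<longleftrightarrow> S \<subseteq> ordset l \<and>
     (\<forall>d\<le>l. uncountable_cof d \<longrightarrow> \<not> stationary_in d (S \<inter> ordset d))"

definition is_cardinal :: "'o::wellorder \<Rightarrow> bool" where
  "is_cardinal k \<longleftrightarrow> (\<forall>a<k. (card_of (ordset a), card_of (ordset k)) \<in> ordLess)"

definition strongly_inaccessible :: "'o::wellorder \<Rightarrow> bool" where
  "strongly_inaccessible k \<longleftrightarrow> is_cardinal k \<and> \<not> countable (ordset k) \<and>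
     (\<forall>X \<subseteq> ordset k. unbounded_in k X \<longrightarrow> (card_of X, card_of (ordset k)) \<in> ordIso) \<and>
     (\<forall>a<k. (card_of (Pow (ordset a)), card_of (ordset k)) \<in> ordLess)"

definition S_inc :: "'o::wellorder \<Rightarrow> 'o set" where
  "S_inc l = {d. d < l \<and> strongly_inaccessible d}"

definition is_Mahlo :: "'o::wellorder \<Rightarrow> bool" where
  "is_Mahlo k \<longleftrightarrow> strongly_inaccessible k \<and> stationary_in k (S_inc k)"

type_synonym 'o cond = "('o \<times> ('o \<Rightarrow> bool)) set"

text \<open>Conditions of Q_lambda, given the ideals I delta = id(Q_delta) for delta < lambda.\<close>
definition Qcond :: "('o::wellorder \<Rightarrow> ('o \<Rightarrow> bool) set set) \<Rightarrow> 'o \<Rightarrow> 'o cond \<Rightarrow> bool" where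
  "Qcond I l p \<longleftrightarrow> p \<subseteq> nodes l \<and>
     (\<forall>eta\<in>p. \<forall>nu\<in>nodes l. initseg nu eta \<longrightarrow> nu \<in> p) \<and>
     (\<exists>tau S N.
        \<comment> \<open>(i) tau is the trunk\<close>
        tau \<in> p \<and> ext tau False \<in> p \<and> ext tau True \<in> p \<and>
        (\<forall>eta\<in>p. ext eta False \<in> p \<and> ext eta True \<in> p \<longrightarrow> initseg tau eta) \<and>
        \<comment> \<open>(ii)\<close>
        (\<forall>eta\<in>p. initseg tau eta \<longrightarrow> ext eta False \<in> p \<and> ext eta True \<in> p) \<and>
        \<comment> \<open>(iii)\<close>
        S \<subseteq> S_inc l \<and> nowhere_stationary l S \<and>
        \<comment> \<open>(iv)\<close>
        (\<forall>d\<in>S. N d \<in> I d) \<and>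
        \<comment> \<open>(v)\<close>
        (\<forall>d<l. limit_ord d \<and> d \<notin> S \<longrightarrow>
            (\<forall>f\<in>seqs d. (d, f) \<in> p \<longleftrightarrow> (\<forall>s<d. (s, rstr f s) \<in> p))) \<and>
        \<comment> \<open>(vi)\<close>
        (\<forall>d\<in>S. \<forall>f\<in>seqs d.
            (d, f) \<in> p \<longleftrightarrow> (\<forall>s<d. (s, rstr f s) \<in> p) \<and> f \<notin> N d))"

definition Qset :: "('o::wellorder \<Rightarrow> ('o \<Rightarrow> bool) set set) \<Rightarrow> 'o \<Rightarrow> 'o cond set" where
  "Qset I l = {p. Qcond I l p}"

definition branches :: "'o::wellorder \<Rightarrow> 'o cond \<Rightarrow> ('o \<Rightarrow> bool) set" where
  "branches l p = {x \<in> seqs l. \<forall>a<l. (a, rstr x a) \<in> p}"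

definition compatible :: "'o cond set \<Rightarrow> 'o cond \<Rightarrow> 'o cond \<Rightarrow> bool" where
  "compatible Q p q \<longleftrightarrow> (\<exists>r\<in>Q. r \<subseteq> p \<and> r \<subseteq> q)"

definition predense :: "'o cond set \<Rightarrow> 'o cond set \<Rightarrow> bool" where
  "predense Q J \<longleftrightarrow> J \<subseteq> Q \<and> (\<forall>p\<in>Q. \<exists>q\<in>J. compatible Q p q)"

definition max_antichain :: "'o cond set \<Rightarrow> 'o cond set \<Rightarrow> bool" where
  "max_antichain Q A \<longleftrightarrow> A \<subseteq> Q \<and>
     (\<forall>p\<in>A. \<forall>q\<in>A. p \<noteq> q \<longrightarrow> \<not> compatible Q p q) \<and>
     (\<forall>p\<in>Q. \<exists>q\<in>A. compatible Q p q)"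

definition set0 :: "'o::wellorder \<Rightarrow> 'o cond set \<Rightarrow> ('o \<Rightarrow> bool) set" where
  "set0 l J = seqs l - (\<Union>p\<in>J. branches l p)"

text \<open>One step of the recursion: id(Q_lambda) from the ideals below lambda.
  "At most lambda many predense sets" = a lambda-indexed family (repetitions allowed).\<close>
definition id_step :: "('o::wellorder \<Rightarrow> ('o \<Rightarrow> bool) set set) \<Rightarrow> 'o \<Rightarrow> ('o \<Rightarrow> bool) set set" where
  "id_step I l = {A. A \<subseteq> seqs l \<and>
     (\<exists>J :: 'o \<Rightarrow> 'o cond set. (\<forall>i<l. predense (Qset I l) (J i)) \<and>
        A \<subseteq> (\<Union>i\<in>ordset l. set0 l (J i)))}"

definition idQ :: "'o::wellorder \<Rightarrow> ('o \<Rightarrow> bool) set set" where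
  "idQ = wfrec {(x, y). x < y} id_step"

definition QQ :: "'o::wellorder \<Rightarrow> 'o cond set" where
  "QQ l = Qset idQ l"

definition id_minus :: "'o::wellorder \<Rightarrow> ('o \<Rightarrow> bool) set set" where
  "id_minus k = {A. A \<subseteq> seqs k \<and> (\<exists>S N. S \<subseteq> S_inc k \<and> nowhere_stationary k S \<and>
      (\<forall>d\<in>S. N d \<in> idQ d) \<and>
      A \<subseteq> {x \<in> seqs k. unbounded_in k {d\<in>S. rstr x d \<in> N d}})}"

definition Pr :: "'o::wellorder \<Rightarrow> bool" where
  "Pr l \<longleftrightarrow> (\<exists>La :: 'o \<Rightarrow> 'o cond set. (\<forall>i<l. max_antichain (QQ l) (La i)) \<and>
     \<not> (\<exists>p\<in>QQ l. branches l p \<subseteq> (\<Inter>i\<in>ordset l. \<Union>q\<in>La i. branches l q)))"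

definition S_pr :: "'o::wellorder \<Rightarrow> 'o set" where
  "S_pr k = {l \<in> S_inc k. Pr l}"

definition nst_pr :: "'o::wellorder \<Rightarrow> 'o set set" where
  "nst_pr k = {A. A \<subseteq> S_pr k \<and> nowhere_stationary k A}"

definition subset_star :: "'o::wellorder \<Rightarrow> 'o set \<Rightarrow> 'o set \<Rightarrow> bool" where
  "subset_star k A B \<longleftrightarrow> bounded_in k (A - B)"

section \<open>Cardinal characteristics, as comparisons of witnessing families\<close>

definition nst_unbounded_family :: "'o::wellorder \<Rightarrow> 'o set set \<Rightarrow> bool" where
  "nst_unbounded_family k F \<longleftrightarrow> F \<subseteq> nst_pr k \<and>
     \<not> (\<exists>B\<in>nst_pr k. \<forall>A\<in>F. subset_star k A B)"

definition nst_cofinal_family :: "'o::wellorder \<Rightarrow> 'o set set \<Rightarrow> bool" where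
  "nst_cofinal_family k C \<longleftrightarrow> C \<subseteq> nst_pr k \<and>
     (\<forall>A\<in>nst_pr k. \<exists>B\<in>C. subset_star k A B)"

definition add_witness :: "'a set set \<Rightarrow> 'a set set \<Rightarrow> 'a set set \<Rightarrow> bool" where
  "add_witness i j A \<longleftrightarrow> A \<subseteq> i \<and> \<Union>A \<notin> j"

definition cf_witness :: "'a set set \<Rightarrow> 'a set set \<Rightarrow> 'a set set \<Rightarrow> bool" where
  "cf_witness i j A \<longleftrightarrow> A \<subseteq> j \<and> (\<forall>B\<in>i. \<exists>C\<in>A. B \<subseteq> C)"

end

(* For a cardinal d with Pr(d) some null set N_d meets [p] for every condition p of Q_d. Send a
   nowhere stationary A to the set of those x with x|d in N_d for unboundedly many d in A, which
   lies in id^-(Q_k). Conversely, let X be covered by the sets set_0(J_i), i < k. For every i and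
   every node t fix, if possible, a condition q(i,t) with trunk t below a member of J_i, with
   witnessing set T(i,t). There are only k many of them because k is a strong limit, and the
   diagonal union W of the T(i,t) is nowhere stationary: at inaccessible levels by the usual
   diagonal argument, and elsewhere because the inaccessibles are nonstationary there.
   If A is not almost contained in W, build a branch x outside X by a fusion of length k.
   Stage i passes below some q(i,t) and then to a node of length d in A - W lying in N_d; this
   node exists because d is not in W, so that the current condition restricts to a condition of
   Q_d all of whose branches survive at level d. Interleaving a club disjoint from W keeps the
   limits of the lengths out of W, so the limit nodes stay in all earlier conditions.
   Hence X bounds the sets attached to A only if A is almost contained in W, and the two maps
   form a Tukey connection giving both inequalities. *)
theory Submission
  imports Defs
begin

unbundle cardinal_syntax

section \<open>Nowhere stationary sets of inaccessibles\<close>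

lemma ordset_iff [simp]: "b \<in> ordset a \<longleftrightarrow> b < a"
  by (simp add: ordset_def)

lemma ordset_mono: "a \<le> b \<Longrightarrow> ordset a \<subseteq> ordset b"
  by auto

lemma unbounded_inI: "(\<And>b. b < d \<Longrightarrow> \<exists>c\<in>X. b \<le> c) \<Longrightarrow> unbounded_in d X"
  by (simp add: unbounded_in_def)

section \<open>Regularity and cofinality of inaccessibles\<close>

lemma inaccessible_infinite:
  "strongly_inaccessible k \<Longrightarrow> infinite (ordset k)"
  unfolding strongly_inaccessible_def by (auto dest: countable_finite)

lemma inaccessible_ordset_less:
  "strongly_inaccessible k \<Longrightarrow> a < k \<Longrightarrow> |ordset a| <o |ordset k|"
  by (simp add: strongly_inaccessible_def is_cardinal_def)

text \<open>An unbounded image would have the full size of \<open>ordset k\<close> by the regularity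
  clause, which speaks of unbounded subsets, but an image of \<open>Z\<close> is no larger than
  \<open>Z\<close>.\<close>

lemma inaccessible_regular:
  assumes k: "strongly_inaccessible k" and Z: "|Z| <o |ordset k|" and f: "f ` Z \<subseteq> ordset k"
  shows "\<exists>b<k. \<forall>z\<in>Z. f z < b"
proof (rule ccontr)
  assume "\<not> ?thesis"
  then have "unbounded_in k (f ` Z)"
    unfolding unbounded_in_def by (meson imageI leI)
  with k f have "|f ` Z| =o |ordset k|"
    unfolding strongly_inaccessible_def by blast
  then have "|ordset k| \<le>o |Z|"
    using card_of_image[of f Z] ordIso_iff_ordLeq ordLeq_transitive by blast
  then show False using Z not_ordLess_ordLeq by blast
qed

lemma inaccessible_uncountable_cof:
  assumes "strongly_inaccessible k"
  shows "uncountable_cof k"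
  unfolding uncountable_cof_def
proof
  assume "\<exists>C\<subseteq>ordset k. countable C \<and> unbounded_in k C"
  then obtain C where C: "C \<subseteq> ordset k" "countable C" "unbounded_in k C" by blast
  then have "|C| =o |ordset k|"
    using assms unfolding strongly_inaccessible_def by blast
  then obtain f where "bij_betw f C (ordset k)"
    using card_of_ordIso by blast
  then have "countable (ordset k)"
    using C(2) by (metis bij_betw_imp_surj_on countable_image)
  then show False using assms unfolding strongly_inaccessible_def by blast
qed

lemma uncountable_cof_limit:
  assumes "uncountable_cof d"
  shows "limit_ord d"
  unfolding limit_ord_def
proof (intro conjI allI impI)
  show "\<exists>b. b < d"
  proof (rule ccontr)
    assume "\<not> ?thesis"
    then have "unbounded_in d {}" by (auto simp: unbounded_in_def)
    then show False using assms unfolding uncountable_cof_def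
      by (metis countable_empty empty_subsetI)
  qed
  fix b assume b: "b < d"
  show "\<exists>c. b < c \<and> c < d"
  proof (rule ccontr)
    assume "\<not> ?thesis"
    then have "unbounded_in d {b}" by (auto simp: unbounded_in_def not_less)
    moreover have "{b} \<subseteq> ordset d" "countable {b}" using b by auto
    ultimately show False using assms unfolding uncountable_cof_def by blast
  qed
qed

lemma inaccessible_limit: "strongly_inaccessible k \<Longrightarrow> limit_ord k"
  by (simp add: inaccessible_uncountable_cof uncountable_cof_limit)

lemma limit_ordD: "limit_ord d \<Longrightarrow> b < d \<Longrightarrow> \<exists>c. b < c \<and> c < d"
  by (simp add: limit_ord_def)

section \<open>Successors, closure points and clubs of limit points\<close>

lemma osucc_greater: "a < b \<Longrightarrow> a < osucc a"
  unfolding osucc_def by (rule LeastI)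

lemma osucc_le: "a < b \<Longrightarrow> osucc a \<le> b"
  unfolding osucc_def by (rule Least_le)

lemma osucc_less_limit: "limit_ord d \<Longrightarrow> a < d \<Longrightarrow> osucc a < d"
  using limit_ordD osucc_le order.strict_trans1 by metis

text \<open>Iterating \<open>F\<close> from \<open>b\<close> gives a countable sequence, whose
  supremum \<open>g\<close> stays below \<open>d\<close> by uncountable cofinality. As
  \<open>F\<close> need not be monotone, closure of \<open>g\<close> under \<open>F\<close> is
  claimed only for cofinally many \<open>y\<close>, namely the iterates.\<close>

lemma closure_point:
  assumes d: "uncountable_cof d"
    and F: "\<And>x. x < d \<Longrightarrow> x < F x \<and> F x < d"
    and b: "b < d"
  shows "\<exists>g<d. b < g \<and> limit_ord g \<and> (\<forall>x<g. \<exists>y\<ge>x. y < g \<and> F y < g)"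
proof -
  define s where "s n = (F ^^ n) b" for n
  have s_Suc: "s (Suc n) = F (s n)" for n by (simp add: s_def)
  have s_d: "s n < d" for n
    by (induction n) (auto simp: s_Suc F, simp add: s_def b)
  have "countable (range s)" "range s \<subseteq> ordset d" using s_d by auto
  then have "\<not> unbounded_in d (range s)"
    using d unfolding uncountable_cof_def by blast
  then obtain u where u: "u < d" "\<And>n. s n < u"
    unfolding unbounded_in_def by (metis not_le rangeI)
  define g where "g = (LEAST u. \<forall>n. s n < u)"
  have g: "s n < g" for n
    unfolding g_def by (rule LeastI2[of _ u]) (use u in auto)
  have gu: "g \<le> u" unfolding g_def by (rule Least_le) (use u in auto)
  have below: "\<exists>n. x \<le> s n" if "x < g" for x
    using not_less_Least[of x "\<lambda>u. \<forall>n. s n < u"] that unfolding g_def by (auto simp: not_less)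
  have closed: "\<exists>y\<ge>x. y < g \<and> F y < g" if x: "x < g" for x
  proof -
    obtain n where "x \<le> s n" using below x by blast
    then show ?thesis using g[of n] g[of "Suc n"] s_Suc by auto
  qed
  have "b < g" using g[of 0] by (simp add: s_def)
  moreover have "limit_ord g"
    unfolding limit_ord_def
  proof (intro conjI allI impI)
    show "\<exists>b. b < g" using g by blast
    fix x assume "x < g"
    then obtain y where y: "x \<le> y" "y < g" "F y < g" using closed by blast
    then have "y < F y" using F u(1) gu by (meson order.strict_trans1 order.strict_trans less_le_trans)
    then show "\<exists>c. x < c \<and> c < g" using y by (meson le_less_trans)
  qed
  ultimately show ?thesis using closed gu u(1) by (meson le_less_trans)
qed

text \<open>Unboundedness comes from a closure point of a function picking larger elements of
  \<open>X\<close>. The lower bound \<open>a\<close> is built in so that the limit points can be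
  kept above the size of a short cofinal set.\<close>

lemma limit_points_club:
  assumes d: "uncountable_cof d" and X: "X \<subseteq> ordset d" "unbounded_in d X" and a: "a < d"
  shows "club_in d {g. a < g \<and> g < d \<and> limit_ord g \<and> unbounded_in g (X \<inter> ordset g)}"
    (is "club_in d ?C")
proof -
  have "\<exists>y\<in>X. x < y" if x: "x < d" for x
  proof -
    obtain z where "x < z" "z < d"
      using limit_ordD[OF uncountable_cof_limit[OF d] x] by blast
    then show ?thesis using X(2) unfolding unbounded_in_def by (meson order.strict_trans2)
  qed
  then obtain F where F: "\<And>x. x < d \<Longrightarrow> F x \<in> X \<and> x < F x" by metis
  have Fd: "x < F x \<and> F x < d" if "x < d" for x using F[OF that] X(1) by auto
  have "unbounded_in d ?C"
  proof (rule unbounded_inI)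
    fix b assume "b < d"
    then have "max a b < d" using a by simp
    from closure_point[OF d Fd this] obtain g where
      g: "g < d" "max a b < g" "limit_ord g" "\<forall>x<g. \<exists>y\<ge>x. y < g \<and> F y < g" by blast
    have "unbounded_in g (X \<inter> ordset g)"
    proof (rule unbounded_inI)
      fix x assume "x < g"
      then obtain y where y: "x \<le> y" "y < g" "F y < g" using g by blast
      then show "\<exists>c\<in>X \<inter> ordset g. x \<le> c"
        using F[of y] g(1) order.strict_trans[of y g d] by (intro bexI[of _ "F y"]) auto
    qed
    then show "\<exists>c\<in>?C. b \<le> c" using g by (intro bexI[of _ g]) auto
  qed
  moreover have "g \<in> ?C" if g: "g < d" "limit_ord g" "unbounded_in g (?C \<inter> ordset g)" for g
  proof -
    have "unbounded_in g (X \<inter> ordset g)"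
    proof (rule unbounded_inI)
      fix x assume "x < g"
      then obtain y where y: "x < y" "y < g" using limit_ordD[OF g(2)] by blast
      then obtain c where c: "c \<in> ?C" "c < g" "y \<le> c"
        using g(3) unfolding unbounded_in_def by auto
      then have "x < c" using y by simp
      then obtain z where "z \<in> X \<inter> ordset c" "x \<le> z"
        using c(1) unfolding unbounded_in_def by blast
      then show "\<exists>c\<in>X \<inter> ordset g. x \<le> c" using c(2) by (intro bexI[of _ z]) auto
    qed
    moreover have "a < g"
    proof -
      obtain y where "y < g" using g(2) unfolding limit_ord_def by blast
      then obtain c where "c \<in> ?C" "c < g"
        using g(3) unfolding unbounded_in_def by auto
      then show ?thesis by auto
    qed
    ultimately show ?thesis using g by auto
  qed
  ultimately show ?thesis unfolding club_in_def by auto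
qed

text \<open>The order of \<open>'o\<close> below \<open>d\<close> is a well-order of
  \<open>ordset d\<close>, so a set of smaller cardinality is in bijection with a proper initial
  segment, and these are exactly the sets \<open>ordset a\<close>.\<close>

lemma ordLess_ordset:
  assumes "|X| <o |ordset d|"
  shows "\<exists>a<d. |X| =o |ordset a|"
proof -
  define r where "r = {(x, y). x \<le> y \<and> y < d}"
  have Fr: "Field r = ordset d" by (auto simp: r_def Field_def)
  have wo: "well_order_on (ordset d) r"
    unfolding well_order_on_def linear_order_on_def partial_order_on_def preorder_on_def
  proof (intro conjI)
    show "refl_on (ordset d) r" "trans r" "antisym r" "total_on (ordset d) r"
      by (auto simp: r_def refl_on_def trans_def antisym_def total_on_def)
    show "r \<subseteq> ordset d \<times> ordset d" by (auto simp: r_def)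
    show "wf (r - Id)"
      by (rule wf_subset[OF wf]) (auto simp: r_def)
  qed
  then have "|ordset d| \<le>o r" by (rule card_of_least)
  with assms have "|X| <o r" using ordLess_ordLeq_trans by blast
  moreover have "Well_order r" using wo Fr by simp
  ultimately obtain a where a: "a \<in> Field r" "|X| =o Restr r (underS r a)"
    using ordLess_iff_ordIso_Restr[of r "|X|"] card_of_Well_order by blast
  have u: "underS r a = ordset a"
    using a(1) Fr by (auto simp: underS_def r_def)
  have "Field (Restr r (underS r a)) = ordset a"
    unfolding u using a(1) Fr by (auto simp: Field_def r_def)
  then have "|X| =o |ordset a|"
    using card_of_cong[OF a(2)] card_of_Field_ordIso[of "|X|"] card_of_Card_order Field_card_of
    by metis
  then show ?thesis using a(1) Fr by auto
qed

text \<open>A limit of inaccessibles is a strong limit cardinal, so it can only fail to be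
  inaccessible by being singular; above the cofinality, no limit point of a short cofinal
  set is regular.\<close>
lemma S_inc_nonstationary_below_accessible:
  assumes d: "uncountable_cof d" and na: "\<not> strongly_inaccessible d"
  shows "\<exists>C. club_in d C \<and> C \<inter> S_inc d = {}"
proof (cases "unbounded_in d (S_inc d)")
  case False
  then obtain b where b: "b < d" "\<And>c. c \<in> S_inc d \<Longrightarrow> c < b"
    unfolding unbounded_in_def by (meson not_le)
  have "club_in d {g. b < g \<and> g < d \<and> limit_ord g \<and> unbounded_in g (ordset d \<inter> ordset g)}"
    by (rule limit_points_club[OF d _ _ b(1)]) (auto simp: unbounded_in_def)
  then show ?thesis using b(2) by (intro exI conjI) (assumption, force)
next
  case True
  have above: "\<exists>c<d. a < c \<and> strongly_inaccessible c" if a: "a < d" for a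
  proof -
    obtain a' where a': "a < a'" "a' < d"
      using limit_ordD[OF uncountable_cof_limit[OF d] a] by blast
    then obtain c where "c \<in> S_inc d" "a' \<le> c" using True unfolding unbounded_in_def by blast
    then show ?thesis using a' unfolding S_inc_def by (intro exI[of _ c]) auto
  qed
  have le: "|ordset c| \<le>o |ordset d|" if "c < d" for c
    using that by (intro card_of_mono1) auto
  \<comment> \<open>Apart from regularity, the clauses of inaccessibility hold at \<open>d\<close>:
    two are inherited from the inaccessibles cofinal in it, and uncountability follows from its
    cofinality.\<close>
  have card: "is_cardinal d"
    unfolding is_cardinal_def using above inaccessible_ordset_less le ordLess_ordLeq_trans
    by metis
  have pow: "\<forall>a<d. |Pow (ordset a)| <o |ordset d|"
    using above le ordLess_ordLeq_trans unfolding strongly_inaccessible_def by metis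
  have unc: "\<not> countable (ordset d)"
  proof
    assume "countable (ordset d)"
    moreover have "unbounded_in d (ordset d)" by (auto simp: unbounded_in_def)
    ultimately show False using d unfolding uncountable_cof_def by blast
  qed
  obtain X where X: "X \<subseteq> ordset d" "unbounded_in d X" "\<not> |X| =o |ordset d|"
    using na card pow unc unfolding strongly_inaccessible_def by blast
  then have "|X| <o |ordset d|"
    using card_of_mono1 ordLeq_iff_ordLess_or_ordIso by blast
  then obtain a where a: "a < d" "|X| =o |ordset a|" using ordLess_ordset by blast
  let ?C = "{g. a < g \<and> g < d \<and> limit_ord g \<and> unbounded_in g (X \<inter> ordset g)}"
  have "club_in d ?C" by (rule limit_points_club[OF d X(1,2) a(1)])
  moreover have "?C \<inter> S_inc d = {}"
  proof (rule ccontr)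
    assume "?C \<inter> S_inc d \<noteq> {}"
    then obtain g where g: "a < g" "unbounded_in g (X \<inter> ordset g)" "strongly_inaccessible g"
      unfolding S_inc_def by blast
    then have "|X \<inter> ordset g| =o |ordset g|"
      unfolding strongly_inaccessible_def by blast
    then have "|ordset g| \<le>o |X|"
      using card_of_mono1[of "X \<inter> ordset g" X] ordIso_ordLeq_trans ordIso_symmetric by blast
    then have "|ordset g| \<le>o |ordset a|" using a(2) ordLeq_ordIso_trans by blast
    then show False using inaccessible_ordset_less[OF g(3,1)] not_ordLess_ordLeq by blast
  qed
  ultimately show ?thesis by blast
qed

lemma nowhere_stationary_subset:
  assumes "nowhere_stationary k S" "T \<subseteq> S"
  shows "nowhere_stationary k T"
  using assms unfolding nowhere_stationary_def stationary_in_def by blast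

lemma nowhere_stationary_club:
  assumes "nowhere_stationary k S" "d \<le> k" "uncountable_cof d"
  shows "\<exists>C. club_in d C \<and> S \<inter> C = {}"
proof -
  have "\<not> stationary_in d (S \<inter> ordset d)"
    using assms unfolding nowhere_stationary_def by blast
  then obtain C where "club_in d C" "S \<inter> ordset d \<inter> C = {}"
    unfolding stationary_in_def by blast
  then show ?thesis unfolding club_in_def by blast
qed

lemma nowhere_stationary_lower:
  assumes "nowhere_stationary k S" "d \<le> k"
  shows "nowhere_stationary d (S \<inter> ordset d)"
proof -
  have "S \<inter> ordset d \<inter> ordset e = S \<inter> ordset e" if "e \<le> d" for e
    using that by auto
  then show ?thesis
    using assms unfolding nowhere_stationary_def by auto
qed

section \<open>Counting nodes, and diagonal unions over nodes\<close>

lemma Times_ordLess_infinite: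
  assumes C: "infinite C" and A: "|A| <o |C|" and B: "|B| <o |C|"
  shows "|A \<times> B| <o |C|"
proof -
  define D where "D = A <+> B"
  have D: "|A| \<le>o |D|" "|B| \<le>o |D|" "|D| <o |C|"
    unfolding D_def using card_of_Plus1 card_of_Plus2 card_of_Plus_ordLess_infinite[OF C A B] by auto
  show ?thesis
  proof (cases "finite D")
    case True
    then have "finite (A \<times> B)"
      by (simp add: D_def)
    then show ?thesis 
      using C finite_ordLess_infinite[of "|A \<times> B|" "|C|"] card_of_Well_order Field_card_of by metis
  next
    case False
    then have "|A \<times> B| \<le>o |D|"
      using D(1,2) card_of_Sigma_ordLeq_infinite[of D A "\<lambda>_. B"] by blast
    then show ?thesis using D(3) ordLeq_ordLess_trans by blast
  qed
qed

text \<open>A node is determined by its length and a subset of \<open>x\<close>, so the strong limit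
  property bounds the number of nodes. The factor \<open>ordset x\<close> is there because diagonal
  unions are indexed by pairs.\<close>

lemma card_of_nodes_less:
  assumes k: "strongly_inaccessible k" and x: "x < k"
  shows "|ordset x \<times> nodes x| <o |ordset k|"
proof -
  have less: "|ordset x| <o |ordset k|" "|Pow (ordset x)| <o |ordset k|"
    using k x unfolding strongly_inaccessible_def is_cardinal_def by auto
  have inj: "inj_on (\<lambda>(a, f). (a, Collect f)) (nodes x)"
    by (auto simp: inj_on_def)
  have img: "(\<lambda>(a, f). (a, Collect f)) ` nodes x \<subseteq> ordset x \<times> Pow (ordset x)"
    by (auto simp: nodes_def seqs_def) (meson not_le order.strict_trans)
  have "|nodes x| \<le>o |ordset x \<times> Pow (ordset x)|"
    using inj img card_of_ordLeq by blast
  moreover have "|ordset x \<times> Pow (ordset x)| <o |ordset k|"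
    by (rule Times_ordLess_infinite[OF inaccessible_infinite[OF k] less])
  ultimately have "|nodes x| <o |ordset k|" using ordLeq_ordLess_trans by blast
  then show ?thesis
    by (rule Times_ordLess_infinite[OF inaccessible_infinite[OF k] less(1)])
qed

lemma nodes_mono: "a \<le> b \<Longrightarrow> nodes a \<subseteq> nodes b"
  by (auto simp: nodes_def)

lemma nodes_iff: "t \<in> nodes g \<longleftrightarrow> fst t < g \<and> snd t \<in> seqs (fst t)"
  by (auto simp: nodes_def)

text \<open>The indices are pairs of a stage and a node, as the fusion needs one choice of condition
  for each such pair. Requiring both coordinates to lie below \<open>d\<close> is what makes the
  union diagonal.\<close>

definition diagonal_union :: "('o::wellorder \<Rightarrow> 'o \<times> ('o \<Rightarrow> bool) \<Rightarrow> 'o set) \<Rightarrow> 'o set" where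
  "diagonal_union T = {d. \<exists>i<d. \<exists>t\<in>nodes d. d \<in> T i t}"

text \<open>The set is disjoint from a diagonal intersection of the clubs \<open>C i t\<close>. That
  intersection is unbounded: fewer than \<open>d\<close> pairs lie below each \<open>x < d\<close>,
  so regularity bounds a choice of one element from each of their clubs, and closure points of this
  bound belong to it.\<close>

lemma diagonal_union_nonstationary:
  assumes d: "strongly_inaccessible d"
    and T: "\<And>i t. i < d \<Longrightarrow> t \<in> nodes d \<Longrightarrow> \<exists>C. club_in d C \<and> T i t \<inter> C = {}"
  shows "\<exists>D. club_in d D \<and> diagonal_union T \<inter> D = {}"
proof -
  have uc: "uncountable_cof d" by (rule inaccessible_uncountable_cof[OF d])
  obtain C where C: "\<And>i t. i < d \<Longrightarrow> t \<in> nodes d \<Longrightarrow> club_in d (C i t)"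
    and TC: "\<And>i t. i < d \<Longrightarrow> t \<in> nodes d \<Longrightarrow> T i t \<inter> C i t = {}"
    using T by metis
  \<comment> \<open>Asking that \<open>C i t\<close> be unbounded below \<open>g\<close>, rather
    than contain \<open>g\<close>, makes \<open>D\<close> easy to prove closed; membership follows
    since the clubs are closed.\<close>
  define D where "D = {g. g < d \<and> limit_ord g \<and>
    (\<forall>i<g. \<forall>t\<in>nodes g. unbounded_in g (C i t \<inter> ordset g))}"
  have "diagonal_union T \<inter> D = {}"
  proof (rule ccontr)
    assume "diagonal_union T \<inter> D \<noteq> {}"
    then obtain g i t where g: "g \<in> D" "i < g" "t \<in> nodes g" "g \<in> T i t"
      unfolding diagonal_union_def by blast
    then have it: "i < d" "t \<in> nodes d" "g < d" "limit_ord g" "unbounded_in g (C i t \<inter> ordset g)"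
      using nodes_mono[of g d] unfolding D_def by (auto simp: nodes_iff)
    then have "g \<in> C i t" using C[of i t] unfolding club_in_def by blast
    then show False using TC[OF it(1,2)] g(4) by blast
  qed
  moreover have "unbounded_in d D"
  proof (rule unbounded_inI)
    fix b assume b: "b < d"
    have "\<exists>y. x < y \<and> y < d \<and> (\<forall>i<x. \<forall>t\<in>nodes x. \<exists>c\<in>C i t. x \<le> c \<and> c < y)" if x: "x < d" for x
    proof -
      define f where "f = (\<lambda>(i, t). SOME c. c \<in> C i t \<and> x \<le> c)"
      have f: "f (i, t) \<in> C i t \<and> x \<le> f (i, t)" if it: "i < x" "t \<in> nodes x" for i t
      proof -
        have "club_in d (C i t)" using C[of i t] it x by (auto simp: nodes_iff)
        then have "\<exists>c. c \<in> C i t \<and> x \<le> c" using x unfolding club_in_def unbounded_in_def by blast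
        then show ?thesis unfolding f_def by (simp add: someI_ex[of "\<lambda>c. c \<in> C i t \<and> x \<le> c"])
      qed
      have "f ` (ordset x \<times> nodes x) \<subseteq> ordset d"
      proof clarify
        fix i a t assume it: "i \<in> ordset x" "(a, t) \<in> nodes x"
        then have "club_in d (C i (a, t))" using C[of i "(a, t)"] x by (auto simp: nodes_iff)
        then show "f (i, a, t) \<in> ordset d" using f[of i "(a, t)"] it unfolding club_in_def by auto
      qed
      from inaccessible_regular[OF d card_of_nodes_less[OF d x] this] obtain y where
        y: "y < d" "\<forall>z\<in>ordset x \<times> nodes x. f z < y" by blast
      have m: "max y (osucc x) < d" "x < max y (osucc x)"
        using y(1) osucc_less_limit[OF uncountable_cof_limit[OF uc] x] osucc_greater[OF x]
        by (auto simp: less_max_iff_disj)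
      have "\<exists>c\<in>C i t. x \<le> c \<and> c < max y (osucc x)" if "i < x" "t \<in> nodes x" for i t
        using f[OF that] y(2) that by (intro bexI[of _ "f (i, t)"]) (auto simp: less_max_iff_disj)
      then show ?thesis using m by blast
    qed
    then obtain F where F: "\<And>x. x < d \<Longrightarrow> x < F x \<and> F x < d"
      and FC: "\<And>x i t. x < d \<Longrightarrow> i < x \<Longrightarrow> t \<in> nodes x \<Longrightarrow> \<exists>c\<in>C i t. x \<le> c \<and> c < F x"
      by metis
    from closure_point[OF uc F b] obtain g where
      g: "g < d" "b < g" "limit_ord g" "\<forall>x<g. \<exists>y\<ge>x. y < g \<and> F y < g" by blast
    have "unbounded_in g (C i t \<inter> ordset g)" if it: "i < g" "t \<in> nodes g" for i t
    proof (rule unbounded_inI)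
      fix x assume "x < g"
      \<comment> \<open>Going past \<open>i\<close> and the length of \<open>t\<close> places the
        pair among those that \<open>F y\<close> takes care of.\<close>
      then have "max x (max i (fst t)) < g" using it by (auto simp: nodes_iff)
      then obtain x' where x': "max x (max i (fst t)) < x'" "x' < g" using limit_ordD[OF g(3)] by blast
      then obtain y where y: "y \<ge> x'" "y < g" "F y < g" using g(4) by blast
      have "i < y" "t \<in> nodes y" "x \<le> y" "y < d" using x' y it g(1) by (auto simp: nodes_iff)
      then obtain c where "c \<in> C i t" "y \<le> c" "c < F y" using FC by blast
      then show "\<exists>c\<in>C i t \<inter> ordset g. x \<le> c" using y(3) \<open>x \<le> y\<close> by (intro bexI[of _ c]) auto
    qed
    then show "\<exists>c\<in>D. b \<le> c" using g unfolding D_def by (intro bexI[of _ g]) auto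
  qed
  moreover have "g \<in> D" if g: "g < d" "limit_ord g" "unbounded_in g (D \<inter> ordset g)" for g
  proof -
    have "unbounded_in g (C i t \<inter> ordset g)" if it: "i < g" "t \<in> nodes g" for i t
    proof (rule unbounded_inI)
      fix x assume "x < g"
      then have "max x (max i (fst t)) < g" using it by (auto simp: nodes_iff)
      then obtain x' where x': "max x (max i (fst t)) < x'" "x' < g" using limit_ordD[OF g(2)] by blast
      then obtain h where h: "h \<in> D" "h < g" "x' \<le> h" using g(3) unfolding unbounded_in_def by auto
      then have "i < h" "t \<in> nodes h" "x < h" using x' it by (auto simp: nodes_iff)
      then obtain c where "c \<in> C i t" "c < h" "x \<le> c"
        using h(1) unfolding D_def unbounded_in_def by force
      then show "\<exists>c\<in>C i t \<inter> ordset g. x \<le> c" using h(2) by (intro bexI[of _ c]) auto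
    qed
    then show ?thesis using g unfolding D_def by auto
  qed
  ultimately have "club_in d D \<and> diagonal_union T \<inter> D = {}"
    unfolding club_in_def by (auto simp: D_def)
  then show ?thesis by blast
qed

lemma diagonal_union_nowhere_stationary:
  assumes T: "\<And>i t. T i t \<subseteq> S_inc k \<and> nowhere_stationary k (T i t)"
  shows "diagonal_union T \<subseteq> S_inc k" "nowhere_stationary k (diagonal_union T)"
proof -
  show inc: "diagonal_union T \<subseteq> S_inc k"
    using T unfolding diagonal_union_def by blast
  show "nowhere_stationary k (diagonal_union T)"
    unfolding nowhere_stationary_def
  proof (intro conjI allI impI)
    show "diagonal_union T \<subseteq> ordset k" using inc unfolding S_inc_def by auto
    fix d assume d: "d \<le> k" "uncountable_cof d"
    have "\<exists>C. club_in d C \<and> diagonal_union T \<inter> C = {}"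
    proof (cases "strongly_inaccessible d")
      case True
      show ?thesis
        by (rule diagonal_union_nonstationary[OF True])
          (use nowhere_stationary_club[OF _ d] T in blast)
    next
      case False
      then obtain C where C: "club_in d C" "C \<inter> S_inc d = {}"
        using S_inc_nonstationary_below_accessible d by blast
      then have "diagonal_union T \<inter> C = {}"
        using inc unfolding S_inc_def club_in_def by fastforce
      then show ?thesis using C by blast
    qed
    then show "\<not> stationary_in d (diagonal_union T \<inter> ordset d)"
      unfolding stationary_in_def by blast
  qed
qed

section \<open>Witnesses and intersections of conditions\<close>

lemma rstr_rstr [simp]: "rstr (rstr f a) b = rstr f (min a b)"
  by (auto simp: rstr_def)

lemma rstr_in_seqs [simp]: "rstr f a \<in> seqs a"
  by (auto simp: rstr_def seqs_def)

lemma rstr_seqs: "f \<in> seqs a \<Longrightarrow> a \<le> b \<Longrightarrow> rstr f b = f"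
  by (rule ext) (auto simp: rstr_def seqs_def not_less)

lemma rstr_apply: "b < a \<Longrightarrow> rstr f a b = f b"
  by (simp add: rstr_def)

lemma initseg_trans: "initseg r s \<Longrightarrow> initseg s t \<Longrightarrow> initseg r t"
  by (auto simp: initseg_def min_def)

lemma initseg_refl: "t \<in> nodes l \<Longrightarrow> initseg t t"
  by (auto simp: initseg_def nodes_iff rstr_seqs)

lemma initseg_linear: "initseg r t \<Longrightarrow> initseg s t \<Longrightarrow> initseg r s \<or> initseg s r"
  using linear[of "fst r" "fst s"] by (auto simp: initseg_def min_def)

lemma initseg_rstr: "a \<le> fst t \<Longrightarrow> initseg (a, rstr (snd t) a) t"
  by (simp add: initseg_def)

lemma initseg_same_length:
  "initseg r s \<or> initseg s r \<Longrightarrow> fst r = fst s \<Longrightarrow> r \<in> nodes l \<Longrightarrow> s \<in> nodes l \<Longrightarrow> r = s"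
  by (auto simp: initseg_def nodes_iff prod_eq_iff rstr_seqs)

lemma ext_in_nodes:
  assumes "limit_ord l" "t \<in> nodes l"
  shows "ext t i \<in> nodes l" "initseg t (ext t i)" "fst t < fst (ext t i)"
proof -
  have l: "fst t < osucc (fst t)" "osucc (fst t) < l"
    using assms osucc_greater[of "fst t" l] osucc_less_limit[of l "fst t"] by (auto simp: nodes_iff)
  then have "(snd t)(fst t := i) \<in> seqs (osucc (fst t))"
    using assms(2) by (force simp: seqs_def nodes_iff)
  then show "ext t i \<in> nodes l" "fst t < fst (ext t i)"
    using l by (auto simp: nodes_iff ext_def)
  have "snd t = rstr ((snd t)(fst t := i)) (fst t)"
    using assms(2) by (auto simp: rstr_def seqs_def nodes_iff not_less)
  then show "initseg t (ext t i)" using l by (simp add: initseg_def ext_def)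
qed

text \<open>The step at \<open>l\<close> consults the earlier ideals only at points of sets
  \<open>S \<subseteq> S_inc l\<close>, all below \<open>l\<close>, so cutting off the recursion at
  \<open>l\<close> changes nothing.\<close>

lemma idQ_unfold: "idQ l = id_step idQ l"
proof -
  have Q: "Qcond (cut idQ {(x, y). x < y} l) l p = Qcond idQ l p" for p
  proof -
    have "cut idQ {(x, y). x < y} l d = idQ d" if "S \<subseteq> S_inc l" "d \<in> S" for S d
      using that by (auto simp: S_inc_def cut_apply)
    then have "S \<subseteq> S_inc l \<Longrightarrow>
        (\<forall>d\<in>S. N d \<in> cut idQ {(x, y). x < y} l d) = (\<forall>d\<in>S. N d \<in> idQ d)" for S N
      by metis
    then show ?thesis unfolding Qcond_def by (simp cong: conj_cong)
  qed
  have "idQ l = id_step (cut idQ {(x, y). x < y} l) l"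
    by (rule def_wfrec[OF eq_reflection[OF idQ_def] wf])
  also have "\<dots> = id_step idQ l"
    unfolding id_step_def Qset_def Q ..
  finally show ?thesis .
qed

lemma idQ_iff:
  "A \<in> idQ l \<longleftrightarrow> A \<subseteq> seqs l \<and>
     (\<exists>J. (\<forall>i<l. predense (QQ l) (J i)) \<and> A \<subseteq> (\<Union>i\<in>ordset l. set0 l (J i)))"
  by (subst idQ_unfold) (simp add: id_step_def QQ_def)

lemma compatible_refl: "p \<in> Q \<Longrightarrow> compatible Q p p"
  by (auto simp: compatible_def)

text \<open>A \<open>K\<close>-indexed union of \<open>l\<close>-indexed unions becomes
  \<open>l\<close>-indexed again by coding the pairs injectively into
  \<open>ordset l\<close>.\<close>

lemma idQ_UNION:
  assumes l: "infinite (ordset l)" and K: "|K| \<le>o |ordset l|"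
    and A: "\<And>x. x \<in> K \<Longrightarrow> A x \<in> idQ l"
  shows "(\<Union>x\<in>K. A x) \<in> idQ l"
proof -
  obtain J where J: "\<And>x i. x \<in> K \<Longrightarrow> i < l \<Longrightarrow> predense (QQ l) (J x i)"
    and AJ: "\<And>x. x \<in> K \<Longrightarrow> A x \<subseteq> (\<Union>i\<in>ordset l. set0 l (J x i))"
    using A unfolding idQ_iff by metis
  have As: "(\<Union>x\<in>K. A x) \<subseteq> seqs l" using A unfolding idQ_iff by blast
  have "|K \<times> ordset l| \<le>o |ordset l|"
    by (rule card_of_Sigma_ordLeq_infinite[OF l K]) (simp add: card_of_mono1)
  then obtain e where e: "inj_on e (K \<times> ordset l)" "e ` (K \<times> ordset l) \<subseteq> ordset l"
    using iffD2[OF card_of_ordLeq, of "K \<times> ordset l" "ordset l"] by blast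
  \<comment> \<open>Indices that code no pair receive the whole forcing, which is predense in
    itself.\<close>
  define J' where "J' j = (if j \<in> e ` (K \<times> ordset l)
    then (case inv_into (K \<times> ordset l) e j of (x, i) \<Rightarrow> J x i) else QQ l)" for j
  have J'e: "J' (e (x, i)) = J x i" if "x \<in> K" "i < l" for x i
    using that e(1) by (auto simp: J'_def)
  have "predense (QQ l) (J' j)" for j
  proof (cases "j \<in> e ` (K \<times> ordset l)")
    case True
    then obtain x i where "x \<in> K" "i < l" "j = e (x, i)" by auto
    then show ?thesis using J'e J by simp
  next
    case False
    then show ?thesis by (auto simp: J'_def predense_def intro: compatible_refl)
  qed
  moreover have "(\<Union>x\<in>K. A x) \<subseteq> (\<Union>j\<in>ordset l. set0 l (J' j))"
  proof
    fix f assume "f \<in> (\<Union>x\<in>K. A x)"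
    then obtain x i where xi: "x \<in> K" "i < l" "f \<in> set0 l (J x i)" using AJ by force
    then have "e (x, i) \<in> ordset l" using e(2) by (metis SigmaI imageI ordset_iff subsetD)
    then show "f \<in> (\<Union>j\<in>ordset l. set0 l (J' j))"
      using xi J'e[OF xi(1,2)] by (intro UN_I[of "e (x, i)"]) auto
  qed
  ultimately show ?thesis using As unfolding idQ_iff by blast
qed

text \<open>The body of \<open>Qcond\<close> for the ideals \<open>idQ\<close> with its clauses
  merged: (i) and (ii) become an equivalence saying that exactly the nodes above \<open>tau\<close>
  split, and (v) and (vi) become one clause for limit levels.\<close>

definition witness :: "'o::wellorder \<Rightarrow> 'o cond \<Rightarrow> 'o \<times> ('o \<Rightarrow> bool) \<Rightarrow> 'o set \<Rightarrow>
    ('o \<Rightarrow> ('o \<Rightarrow> bool) set) \<Rightarrow> bool" where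
  "witness l p tau S N \<longleftrightarrow> p \<subseteq> nodes l \<and>
     (\<forall>eta\<in>p. \<forall>nu\<in>nodes l. initseg nu eta \<longrightarrow> nu \<in> p) \<and>
     tau \<in> p \<and>
     (\<forall>eta\<in>p. ext eta False \<in> p \<and> ext eta True \<in> p \<longleftrightarrow> initseg tau eta) \<and>
     S \<subseteq> S_inc l \<and> nowhere_stationary l S \<and> (\<forall>d\<in>S. N d \<in> idQ d) \<and>
     (\<forall>d<l. limit_ord d \<longrightarrow> (\<forall>f\<in>seqs d.
        (d, f) \<in> p \<longleftrightarrow> (\<forall>s<d. (s, rstr f s) \<in> p) \<and> (d \<in> S \<longrightarrow> f \<notin> N d)))"

lemma S_inc_limit: "S \<subseteq> S_inc l \<Longrightarrow> d \<in> S \<Longrightarrow> limit_ord d \<and> d < l"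
  by (auto simp: S_inc_def inaccessible_limit)

lemma witnessD:
  assumes "witness l p tau S N"
  shows "p \<subseteq> nodes l" "\<And>eta nu. eta \<in> p \<Longrightarrow> nu \<in> nodes l \<Longrightarrow> initseg nu eta \<Longrightarrow> nu \<in> p"
    "tau \<in> p" "\<And>eta i. eta \<in> p \<Longrightarrow> initseg tau eta \<Longrightarrow> ext eta i \<in> p"
    "\<And>eta. eta \<in> p \<Longrightarrow> ext eta False \<in> p \<Longrightarrow> ext eta True \<in> p \<Longrightarrow> initseg tau eta"
    "S \<subseteq> S_inc l" "nowhere_stationary l S" "\<And>d. d \<in> S \<Longrightarrow> N d \<in> idQ d"
    "\<And>d f. d < l \<Longrightarrow> limit_ord d \<Longrightarrow> f \<in> seqs d \<Longrightarrow>
      (d, f) \<in> p \<longleftrightarrow> (\<forall>s<d. (s, rstr f s) \<in> p) \<and> (d \<in> S \<longrightarrow> f \<notin> N d)"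
proof -
  have split: "\<forall>eta\<in>p. ext eta False \<in> p \<and> ext eta True \<in> p \<longleftrightarrow> initseg tau eta"
    using assms unfolding witness_def by (elim conjE)
  show "ext eta i \<in> p" if "eta \<in> p" "initseg tau eta" for eta i
    using bspec[OF split that(1)] that(2) by (cases i) simp_all
  show "initseg tau eta" if "eta \<in> p" "ext eta False \<in> p" "ext eta True \<in> p" for eta
    using bspec[OF split that(1)] that(2,3) by simp
  have "\<forall>eta\<in>p. \<forall>nu\<in>nodes l. initseg nu eta \<longrightarrow> nu \<in> p"
    using assms unfolding witness_def by (elim conjE)
  then show "nu \<in> p" if "eta \<in> p" "nu \<in> nodes l" "initseg nu eta" for eta nu
    using that by simp
  have lim: "\<forall>d<l. limit_ord d \<longrightarrow> (\<forall>f\<in>seqs d.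
      (d, f) \<in> p \<longleftrightarrow> (\<forall>s<d. (s, rstr f s) \<in> p) \<and> (d \<in> S \<longrightarrow> f \<notin> N d))"
    using assms unfolding witness_def by (elim conjE)
  show "(d, f) \<in> p \<longleftrightarrow> (\<forall>s<d. (s, rstr f s) \<in> p) \<and> (d \<in> S \<longrightarrow> f \<notin> N d)"
    if "d < l" "limit_ord d" "f \<in> seqs d" for d f
    using that by (rule lim[rule_format])
  have "\<forall>d\<in>S. N d \<in> idQ d" using assms unfolding witness_def by (elim conjE)
  then show "N d \<in> idQ d" if "d \<in> S" for d using that by (rule bspec)
  show "p \<subseteq> nodes l" using assms unfolding witness_def by (elim conjE)
  show "tau \<in> p" using assms unfolding witness_def by (elim conjE)
  show "S \<subseteq> S_inc l" using assms unfolding witness_def by (elim conjE)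
  show "nowhere_stationary l S" using assms unfolding witness_def by (elim conjE)
qed

text \<open>Points of \<open>S\<close> are inaccessible, hence limits below \<open>l\<close>, so the
  clause for \<open>S\<close> is an instance of the merged one; the trunk splits because it is an
  initial segment of itself.\<close>

lemma QQ_iff: "p \<in> QQ l \<longleftrightarrow> (\<exists>tau S N. witness l p tau S N)"
proof -
  have "(p \<subseteq> nodes l \<and> (\<forall>eta\<in>p. \<forall>nu\<in>nodes l. initseg nu eta \<longrightarrow> nu \<in> p) \<and>
       tau \<in> p \<and> ext tau False \<in> p \<and> ext tau True \<in> p \<and>
        (\<forall>eta\<in>p. ext eta False \<in> p \<and> ext eta True \<in> p \<longrightarrow> initseg tau eta) \<and>
        (\<forall>eta\<in>p. initseg tau eta \<longrightarrow> ext eta False \<in> p \<and> ext eta True \<in> p) \<and>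
        S \<subseteq> S_inc l \<and> nowhere_stationary l S \<and>
        (\<forall>d\<in>S. N d \<in> idQ d) \<and>
        (\<forall>d<l. limit_ord d \<and> d \<notin> S \<longrightarrow>
            (\<forall>f\<in>seqs d. (d, f) \<in> p \<longleftrightarrow> (\<forall>s<d. (s, rstr f s) \<in> p))) \<and>
        (\<forall>d\<in>S. \<forall>f\<in>seqs d.
            (d, f) \<in> p \<longleftrightarrow> (\<forall>s<d. (s, rstr f s) \<in> p) \<and> f \<notin> N d)) \<longleftrightarrow>
      witness l p tau S N" (is "?L \<longleftrightarrow> ?R") for tau S N
  proof
    assume L: ?L
    have v: "\<forall>d<l. limit_ord d \<and> d \<notin> S \<longrightarrow>
        (\<forall>f\<in>seqs d. (d, f) \<in> p \<longleftrightarrow> (\<forall>s<d. (s, rstr f s) \<in> p))"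
      using L by (elim conjE)
    have vi: "\<forall>d\<in>S. \<forall>f\<in>seqs d. (d, f) \<in> p \<longleftrightarrow> (\<forall>s<d. (s, rstr f s) \<in> p) \<and> f \<notin> N d"
      using L by (elim conjE)
    have split: "\<forall>eta\<in>p. ext eta False \<in> p \<and> ext eta True \<in> p \<longrightarrow> initseg tau eta"
      using L by (elim conjE)
    have split': "\<forall>eta\<in>p. initseg tau eta \<longrightarrow> ext eta False \<in> p \<and> ext eta True \<in> p"
      using L by (elim conjE)
    show ?R unfolding witness_def
    proof (intro conjI)
      show "p \<subseteq> nodes l" using L by (elim conjE)
      show "\<forall>eta\<in>p. \<forall>nu\<in>nodes l. initseg nu eta \<longrightarrow> nu \<in> p" using L by (elim conjE)
      show "tau \<in> p" using L by (elim conjE)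
      show "S \<subseteq> S_inc l" using L by (elim conjE)
      show "nowhere_stationary l S" using L by (elim conjE)
      show "\<forall>d\<in>S. N d \<in> idQ d" using L by (elim conjE)
      show "\<forall>eta\<in>p. ext eta False \<in> p \<and> ext eta True \<in> p \<longleftrightarrow> initseg tau eta"
        using split split' by blast
      have "(d, f) \<in> p \<longleftrightarrow> (\<forall>s<d. (s, rstr f s) \<in> p) \<and> (d \<in> S \<longrightarrow> f \<notin> N d)"
        if "d < l" "limit_ord d" "f \<in> seqs d" for d f
      proof (cases "d \<in> S")
        case True
        then show ?thesis using vi[rule_format, OF True that(3)] by simp
      next
        case False
        then show ?thesis using v[rule_format, of d f] that by simp
      qed
      then show "\<forall>d<l. limit_ord d \<longrightarrow> (\<forall>f\<in>seqs d. (d, f) \<in> p \<longleftrightarrow>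
          (\<forall>s<d. (s, rstr f s) \<in> p) \<and> (d \<in> S \<longrightarrow> f \<notin> N d))"
        by (intro allI impI ballI)
    qed
  next
    assume R: ?R
    have p: "tau \<in> nodes l" "tau \<in> p" "S \<subseteq> S_inc l"
      using witnessD(1,3,6)[OF R] by auto
    have split: "\<forall>eta\<in>p. ext eta False \<in> p \<and> ext eta True \<in> p \<longleftrightarrow> initseg tau eta"
      using R unfolding witness_def by (elim conjE)
    note lim = witnessD(9)[OF R]
    have tau: "ext tau False \<in> p" "ext tau True \<in> p"
      using split initseg_refl[OF p(1)] p(2) by blast+
    show ?L
    proof (intro conjI)
      show "\<forall>d<l. limit_ord d \<and> d \<notin> S \<longrightarrow>
        (\<forall>f\<in>seqs d. (d, f) \<in> p \<longleftrightarrow> (\<forall>s<d. (s, rstr f s) \<in> p))"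
      proof (intro allI impI ballI)
        fix d f assume "d < l" "limit_ord d \<and> d \<notin> S" "f \<in> seqs d"
        then show "(d, f) \<in> p \<longleftrightarrow> (\<forall>s<d. (s, rstr f s) \<in> p)" using lim[of d f] by simp
      qed
      show "\<forall>d\<in>S. \<forall>f\<in>seqs d. (d, f) \<in> p \<longleftrightarrow> (\<forall>s<d. (s, rstr f s) \<in> p) \<and> f \<notin> N d"
      proof (intro ballI)
        fix d f assume "d \<in> S" "f \<in> seqs d"
        then show "(d, f) \<in> p \<longleftrightarrow> (\<forall>s<d. (s, rstr f s) \<in> p) \<and> f \<notin> N d"
          using lim[of d f] S_inc_limit[OF p(3), of d] by simp
      qed
      show "\<forall>eta\<in>p. ext eta False \<in> p \<and> ext eta True \<in> p \<longrightarrow> initseg tau eta"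
        "\<forall>eta\<in>p. initseg tau eta \<longrightarrow> ext eta False \<in> p \<and> ext eta True \<in> p"
        using split by blast+
      show "\<forall>eta\<in>p. \<forall>nu\<in>nodes l. initseg nu eta \<longrightarrow> nu \<in> p"
        using R unfolding witness_def by (elim conjE)
      show "p \<subseteq> nodes l" "S \<subseteq> S_inc l" "nowhere_stationary l S" "\<forall>d\<in>S. N d \<in> idQ d"
        using witnessD(1,6,7,8)[OF R] by blast+
    qed (rule tau p)+
  qed
  from this[symmetric] show ?thesis
    by (simp only: QQ_def Qset_def Qcond_def mem_Collect_eq ex_simps)
qed

lemma witness_rstr:
  assumes "witness l p tau S N" "eta \<in> p" "a \<le> fst eta"
  shows "(a, rstr (snd eta) a) \<in> p"
proof (rule witnessD(2)[OF assms(1,2) _ initseg_rstr[OF assms(3)]])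
  have "eta \<in> nodes l" using witnessD(1)[OF assms(1)] assms(2) by blast
  then show "(a, rstr (snd eta) a) \<in> nodes l" using assms(3) by (auto simp: nodes_iff)
qed

lemma initseg_iff: "r \<in> nodes l \<Longrightarrow>
    initseg r s \<longleftrightarrow> fst r \<le> fst s \<and> (\<forall>b<fst r. snd r b = snd s b)"
  by (auto simp: initseg_def rstr_def nodes_iff seqs_def fun_eq_iff not_less)

text \<open>Serves to pass from conditions at \<open>k\<close> to conditions at \<open>d\<close>,
  where a null set meeting all conditions is available. The trunk must be shorter than
  \<open>d\<close> to survive the cut.\<close>

lemma witness_restrict:
  assumes w: "witness l p tau S N" and d: "d \<le> l" "limit_ord d" "fst tau < d"
  shows "witness d (p \<inter> nodes d) tau (S \<inter> ordset d) N"
proof -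
  have sub: "nodes d \<subseteq> nodes l" by (rule nodes_mono[OF d(1)])
  have tau: "tau \<in> nodes d" using witnessD(1,3)[OF w] d by (auto simp: nodes_iff)
  have lim: "(e, f) \<in> p \<inter> nodes d \<longleftrightarrow>
      (\<forall>s<e. (s, rstr f s) \<in> p \<inter> nodes d) \<and> (e \<in> S \<inter> ordset d \<longrightarrow> f \<notin> N e)"
    if "e < d" "limit_ord e" "f \<in> seqs e" for e f
  proof -
    have "(s, rstr f s) \<in> nodes d" if "s < e" for s
      using that \<open>e < d\<close> by (auto simp: nodes_iff)
    then have 1: "(\<forall>s<e. (s, rstr f s) \<in> p \<inter> nodes d) \<longleftrightarrow> (\<forall>s<e. (s, rstr f s) \<in> p)"
      by blast
    have 2: "(e, f) \<in> p \<inter> nodes d \<longleftrightarrow> (e, f) \<in> p" "e \<in> S \<inter> ordset d \<longleftrightarrow> e \<in> S"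
      using that by (auto simp: nodes_iff)
    have "e < l" using that(1) d(1) by simp
    then show ?thesis unfolding 1 2 by (rule witnessD(9)[OF w _ that(2,3)])
  qed
  have split: "ext eta False \<in> p \<inter> nodes d \<and> ext eta True \<in> p \<inter> nodes d \<longleftrightarrow> initseg tau eta"
    if "eta \<in> p \<inter> nodes d" for eta
    using that ext_in_nodes(1)[OF d(2)] witnessD(4,5)[OF w, of eta] by blast
  show ?thesis unfolding witness_def
  proof (intro conjI allI impI ballI)
    show "nowhere_stationary d (S \<inter> ordset d)"
      by (rule nowhere_stationary_lower[OF witnessD(7)[OF w] d(1)])
    show "S \<inter> ordset d \<subseteq> S_inc d" using witnessD(6)[OF w] by (auto simp: S_inc_def)
    show "e < d \<Longrightarrow> limit_ord e \<Longrightarrow> f \<in> seqs e \<Longrightarrow> (e, f) \<in> p \<inter> nodes d \<longleftrightarrow>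
      (\<forall>s<e. (s, rstr f s) \<in> p \<inter> nodes d) \<and> (e \<in> S \<inter> ordset d \<longrightarrow> f \<notin> N e)" for e f
      by (rule lim)
  qed (use tau split witnessD(1,2,3,8)[OF w] sub in blast)+
qed

text \<open>Above the common node \<open>mu\<close>, which extends all trunks, a node splits in the
  intersection since it splits in every condition. At \<open>d \<in> S\<close> beyond
  \<open>mu\<close>, at most |d| null sets are removed, so their union is in \<open>idQ d\<close>.
  Levels up to the length of \<open>mu\<close> need no null sets, because only initial segments of
  \<open>mu\<close> are left there.\<close>

lemma witness_Inter:
  assumes l: "limit_ord l" and mu: "mu \<in> nodes l"
    and w: "\<And>x. x \<in> K \<Longrightarrow> witness l (q x) (t x) (T x) (M x)"
    and t: "\<And>x. x \<in> K \<Longrightarrow> initseg (t x) mu" and mu_q: "\<And>x. x \<in> K \<Longrightarrow> mu \<in> q x"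
    and T: "\<And>x d. x \<in> K \<Longrightarrow> d \<in> T x \<Longrightarrow> fst mu < d \<Longrightarrow> d \<in> S"
    and S: "S \<subseteq> S_inc l" "nowhere_stationary l S"
    and K: "\<And>d. d \<in> S \<Longrightarrow> fst mu < d \<Longrightarrow> |K| \<le>o |ordset d|"
  shows "\<exists>N. witness l {eta \<in> nodes l. (initseg mu eta \<or> initseg eta mu) \<and> (\<forall>x\<in>K. eta \<in> q x)}
    mu {d \<in> S. fst mu < d} N"
proof -
  define p where "p = {eta \<in> nodes l. (initseg mu eta \<or> initseg eta mu) \<and> (\<forall>x\<in>K. eta \<in> q x)}"
  define N where "N d = (\<Union>x\<in>{x\<in>K. d \<in> T x}. M x d)" for d
  have closed: "nu \<in> p" if "eta \<in> p" "nu \<in> nodes l" "initseg nu eta" for eta nu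
    using that initseg_trans[of nu eta mu] initseg_linear[of nu eta mu] witnessD(2)[OF w]
    unfolding p_def by blast
  have mu_p: "mu \<in> p" using mu mu_q initseg_refl[OF mu] by (auto simp: p_def)
  have ext_p: "ext eta i \<in> p" if "eta \<in> p" "initseg mu eta" for eta i
  proof -
    have eta: "eta \<in> nodes l" using that by (auto simp: p_def)
    have "ext eta i \<in> q x" if "x \<in> K" for x
      using witnessD(4)[OF w[OF that], of eta] initseg_trans[OF t[OF that]] that
        \<open>eta \<in> p\<close> \<open>initseg mu eta\<close> by (auto simp: p_def)
    then show ?thesis
      using ext_in_nodes[OF l eta] initseg_trans[OF that(2), of "ext eta i"] by (auto simp: p_def)
  qed
  have split: "initseg mu eta" if "eta \<in> p" "ext eta False \<in> p" "ext eta True \<in> p" for eta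
  proof (rule ccontr)
    assume n: "\<not> ?thesis"
    have eta: "eta \<in> nodes l" "initseg eta mu" using that n by (auto simp: p_def)
    then have less: "fst eta < fst mu"
      using n initseg_same_length[of eta mu] eta(1) mu initseg_refl[OF mu]
      by (metis initseg_def order_le_imp_less_or_eq)
    \<comment> \<open>The successor of \<open>eta\<close> that disagrees with \<open>mu\<close>;
      belonging to \<open>p\<close>, it would have to be an initial segment of
      \<open>mu\<close>.\<close>
    let ?e = "ext eta (\<not> snd mu (fst eta))"
    have e: "?e \<in> p" using that by (cases "snd mu (fst eta)") auto
    have len: "fst ?e \<le> fst mu" using less osucc_le by (auto simp: ext_def)
    have "snd ?e (fst eta) \<noteq> snd mu (fst eta)" by (simp add: ext_def)
    moreover have "initseg ?e mu"
      using e len initseg_same_length[of ?e mu] mu initseg_refl[OF mu]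
      unfolding p_def by (metis (no_types, lifting) initseg_def mem_Collect_eq order_antisym)
    ultimately show False
      using initseg_iff[of ?e l mu] ext_in_nodes(1,3)[OF l eta(1)] by blast
  qed
  have idN: "N d \<in> idQ d" if d: "d \<in> S" "fst mu < d" for d
    unfolding N_def
  proof (rule idQ_UNION)
    show "infinite (ordset d)" using d S(1) inaccessible_infinite by (auto simp: S_inc_def)
    show "|{x \<in> K. d \<in> T x}| \<le>o |ordset d|"
      using card_of_mono1[of "{x \<in> K. d \<in> T x}" K] K[OF d] ordLeq_transitive by blast
  qed (use witnessD(8)[OF w] in blast)
  have lim: "(d, f) \<in> p \<longleftrightarrow>
      (\<forall>s<d. (s, rstr f s) \<in> p) \<and> (d \<in> {d \<in> S. fst mu < d} \<longrightarrow> f \<notin> N d)"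
    if d: "d < l" "limit_ord d" and f: "f \<in> seqs d" for d f
  proof
    assume df: "(d, f) \<in> p"
    have "(s, rstr f s) \<in> p" if "s < d" for s
      by (rule closed[OF df]) (use that d in \<open>auto simp: nodes_iff initseg_def\<close>)
    moreover have "f \<notin> M x d" if "x \<in> K" "d \<in> T x" for x
    proof -
      have "(d, f) \<in> q x" using df that by (simp add: p_def)
      then show ?thesis using witnessD(9)[OF w[OF that(1)] d f] that by blast
    qed
    ultimately show "(\<forall>s<d. (s, rstr f s) \<in> p) \<and> (d \<in> {d \<in> S. fst mu < d} \<longrightarrow> f \<notin> N d)"
      by (auto simp: N_def)
  next
    assume R: "(\<forall>s<d. (s, rstr f s) \<in> p) \<and> (d \<in> {d \<in> S. fst mu < d} \<longrightarrow> f \<notin> N d)"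
    have df: "(d, f) \<in> nodes l" using d f by (auto simp: nodes_iff)
    show "(d, f) \<in> p"
    proof (cases "fst mu < d")
      case True
      have "(fst mu, rstr f (fst mu)) \<in> p" using R True by blast
      then have "mu = (fst mu, rstr f (fst mu))"
        using initseg_same_length[of mu "(fst mu, rstr f (fst mu))" l] mu by (auto simp: p_def)
      then have "initseg mu (d, f)" using True by (metis initseg_def fst_conv snd_conv less_imp_le)
      moreover have "(d, f) \<in> q x" if x: "x \<in> K" for x
      proof -
        have "\<forall>s<d. (s, rstr f s) \<in> q x" using R x by (simp add: p_def)
        moreover have "f \<notin> M x d" if "d \<in> T x"
          using R T[OF x that True] True x that by (auto simp: N_def)
        ultimately show ?thesis using witnessD(9)[OF w[OF x] d f] by blast
      qed
      ultimately show ?thesis using df by (auto simp: p_def)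
    next
      \<comment> \<open>When \<open>d\<close> is at most the length of \<open>mu\<close>, the
        restrictions of \<open>f\<close> are initial segments of \<open>mu\<close>, and hence so is
        \<open>f\<close>.\<close>
      case False
      have f_mu: "f b = snd mu b" if b: "b < d" for b
      proof -
        obtain c where c: "b < c" "c < d" using limit_ordD[OF d(2) b] by blast
        have "(c, rstr f c) \<in> p" using R c by blast
        then have "(c, rstr f c) \<in> nodes l" "initseg (c, rstr f c) mu"
          using c(2) False by (auto simp: p_def initseg_def[of mu])
        then show ?thesis using initseg_iff[of "(c, rstr f c)" l mu] c(1) by (simp add: rstr_apply)
      qed
      have "initseg (d, f) mu" unfolding initseg_iff[OF df] using False f_mu by simp
      then show ?thesis using closed[OF mu_p df] by blast
    qed
  qed
  have "witness l p mu {d \<in> S. fst mu < d} N"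
    unfolding witness_def
  proof (intro conjI allI impI ballI)
    show "p \<subseteq> nodes l" by (auto simp: p_def)
    show "nowhere_stationary l {d \<in> S. fst mu < d}"
      by (rule nowhere_stationary_subset[OF S(2)]) blast
    show "d < l \<Longrightarrow> limit_ord d \<Longrightarrow> f \<in> seqs d \<Longrightarrow> (d, f) \<in> p \<longleftrightarrow>
      (\<forall>s<d. (s, rstr f s) \<in> p) \<and> (d \<in> {d \<in> S. fst mu < d} \<longrightarrow> f \<notin> N d)" for d f
      by (rule lim)
  qed (use closed mu_p ext_p split idN S(1) in blast)+
  then show ?thesis unfolding p_def by blast
qed

section \<open>The fusion argument\<close>

text \<open>A maximal antichain is predense, so the points missed by some antichain of the family
  witnessing \<open>Pr\<close> form a null set. A condition with no branch in it would have all its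
  branches captured by every antichain.\<close>

lemma QQ_heavy_null:
  assumes "Pr d"
  shows "\<exists>N\<in>idQ d. \<forall>p\<in>QQ d. branches d p \<inter> N \<noteq> {}"
proof -
  obtain La where La: "\<And>i. i < d \<Longrightarrow> max_antichain (QQ d) (La i)"
    and n: "\<And>p. p \<in> QQ d \<Longrightarrow> \<not> branches d p \<subseteq> (\<Inter>i\<in>ordset d. \<Union>q\<in>La i. branches d q)"
    using assms unfolding Pr_def by blast
  define N where "N = (\<Union>i\<in>ordset d. set0 d (La i))"
  have "\<forall>i<d. predense (QQ d) (La i)"
    using La unfolding max_antichain_def predense_def by blast
  then have "N \<in> idQ d" unfolding idQ_iff N_def by (auto simp: set0_def)
  moreover have "branches d p \<inter> N \<noteq> {}" if p: "p \<in> QQ d" for p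
  proof -
    obtain x where x: "x \<in> branches d p" "x \<notin> (\<Inter>i\<in>ordset d. \<Union>q\<in>La i. branches d q)"
      using n[OF p] unfolding subset_iff not_all not_imp by (elim exE conjE)
    then obtain i where "i < d" "x \<notin> (\<Union>q\<in>La i. branches d q)" by auto
    moreover have "x \<in> seqs d" using x(1) by (simp add: branches_def)
    ultimately have "x \<in> N" by (auto simp: N_def set0_def)
    then show ?thesis using x(1) by blast
  qed
  ultimately show ?thesis by blast
qed

definition heavy_null :: "'o::wellorder \<Rightarrow> ('o \<Rightarrow> bool) set" where
  "heavy_null d = (SOME N. N \<in> idQ d \<and> (\<forall>p\<in>QQ d. branches d p \<inter> N \<noteq> {}))"

lemma heavy_null:
  assumes "Pr d"
  shows "heavy_null d \<in> idQ d" "p \<in> QQ d \<Longrightarrow> branches d p \<inter> heavy_null d \<noteq> {}"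
proof -
  have "heavy_null d \<in> idQ d \<and> (\<forall>p\<in>QQ d. branches d p \<inter> heavy_null d \<noteq> {})"
    unfolding heavy_null_def
    by (rule someI_ex) (use QQ_heavy_null[OF assms] in \<open>simp add: Bex_def\<close>)
  then show "heavy_null d \<in> idQ d" "p \<in> QQ d \<Longrightarrow> branches d p \<inter> heavy_null d \<noteq> {}" by simp_all
qed

text \<open>One of the two maps of the Tukey connection, from \<open>nst_pr k\<close> into
  \<open>id_minus k\<close>.\<close>

definition caught :: "'o::wellorder \<Rightarrow> 'o set \<Rightarrow> ('o \<Rightarrow> bool) set" where
  "caught k A = {x \<in> seqs k. unbounded_in k {d \<in> A. rstr x d \<in> heavy_null d}}"

lemma caught_id_minus: "A \<in> nst_pr k \<Longrightarrow> caught k A \<in> id_minus k"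
  unfolding id_minus_def nst_pr_def S_pr_def caught_def
  using heavy_null(1) by (intro CollectI conjI exI[of _ A] exI[of _ heavy_null]) auto

lemma nowhere_stationary_empty: "nowhere_stationary k {}"
proof -
  have "club_in d (ordset d)" for d :: 'a
    by (auto simp: club_in_def unbounded_in_def)
  then show ?thesis unfolding nowhere_stationary_def stationary_in_def by blast
qed

text \<open>Nodes of a chain agree on their common domain, so their union is well defined. The
  second conclusion makes it false from the supremum of the lengths on, as the coding of sequences
  demands.\<close>

lemma chain_union:
  fixes r :: "'i \<Rightarrow> 'o::wellorder \<times> ('o \<Rightarrow> bool)"
  assumes chain: "\<And>i j. i \<in> I \<Longrightarrow> j \<in> I \<Longrightarrow> initseg (r i) (r j) \<or> initseg (r j) (r i)"
    and r: "\<And>i. i \<in> I \<Longrightarrow> snd (r i) \<in> seqs (fst (r i))"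
  shows "\<exists>x. (\<forall>i\<in>I. rstr x (fst (r i)) = snd (r i)) \<and>
    (\<forall>b. (\<forall>i\<in>I. fst (r i) \<le> b) \<longrightarrow> \<not> x b)"
proof (intro exI conjI ballI allI impI)
  define x where "x b = (\<exists>i\<in>I. snd (r i) b)" for b
  show "rstr x (fst (r i)) = snd (r i)" if i: "i \<in> I" for i
  proof
    fix b
    have "snd (r i) b" if j: "j \<in> I" "snd (r j) b" and b: "b < fst (r i)" for j
      using chain[OF i j(1)] j(2) b by (auto simp: initseg_def rstr_def split: if_splits)
    then show "rstr x (fst (r i)) b = snd (r i) b"
      using i r[OF i] by (auto simp: rstr_def x_def seqs_def not_less)
  qed
  show "\<not> x b" if "\<forall>i\<in>I. fst (r i) \<le> b" for b
    using that r by (auto simp: x_def seqs_def)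
qed

text \<open>Here \<open>q i t\<close> is the fixed choice of a condition with trunk \<open>t\<close>
  below a member of \<open>J i\<close>, correct whenever one exists. \<open>T i t\<close> is nowhere
  stationary at every index, even where there is no such condition, so that the diagonal union is
  nowhere stationary.\<close>

locale fusion =
  fixes k :: "'o::wellorder" and J :: "'o \<Rightarrow> 'o cond set"
    and q :: "'o \<Rightarrow> 'o \<times> ('o \<Rightarrow> bool) \<Rightarrow> 'o cond"
    and T :: "'o \<Rightarrow> 'o \<times> ('o \<Rightarrow> bool) \<Rightarrow> 'o set"
    and M :: "'o \<Rightarrow> 'o \<times> ('o \<Rightarrow> bool) \<Rightarrow> 'o \<Rightarrow> ('o \<Rightarrow> bool) set"
    and C A :: "'o set"
  assumes k: "strongly_inaccessible k"
    and J: "\<And>i. i < k \<Longrightarrow> predense (QQ k) (J i)"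
    and T: "\<And>i t. T i t \<subseteq> S_inc k \<and> nowhere_stationary k (T i t)"
    and q: "\<And>i t m r S N. m \<in> J i \<Longrightarrow> r \<subseteq> m \<Longrightarrow> witness k r t S N \<Longrightarrow>
      witness k (q i t) t (T i t) (M i t) \<and> (\<exists>m\<in>J i. q i t \<subseteq> m)"
    and C: "club_in k C" "diagonal_union T \<inter> C = {}"
    and A: "A \<subseteq> S_pr k" "unbounded_in k (A - diagonal_union T)"
begin

abbreviation "W \<equiv> diagonal_union T"

text \<open>Singles out the indices at which \<open>q i t\<close> is a genuine condition; elsewhere
  it may be an arbitrary value.\<close>

definition usable :: "'o \<Rightarrow> 'o \<times> ('o \<Rightarrow> bool) \<Rightarrow> bool" where
  "usable i t \<longleftrightarrow> witness k (q i t) t (T i t) (M i t) \<and> (\<exists>m\<in>J i. q i t \<subseteq> m)"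

text \<open>The room left for an element of C between the lengths of t and u puts every limit of
  lengths into C, hence outside the diagonal union.\<close>
definition stage :: "('o \<Rightarrow> ('o \<times> ('o \<Rightarrow> bool)) \<times> ('o \<times> ('o \<Rightarrow> bool))) \<Rightarrow> 'o \<Rightarrow>
    ('o \<times> ('o \<Rightarrow> bool)) \<Rightarrow> ('o \<times> ('o \<Rightarrow> bool)) \<Rightarrow> bool" where
  "stage f i t u \<longleftrightarrow>
     (\<forall>j<i. initseg (snd (f j)) t \<and> u \<in> q j (fst (f j))) \<and> u \<in> q i t \<and>
     i \<le> fst t \<and> t \<in> nodes k \<and> u \<in> nodes k \<and> usable i t \<and> initseg t u \<and>
     fst u \<in> A - W \<and> snd u \<in> heavy_null (fst u) \<and> (\<exists>c\<in>C. fst t < c \<and> c < fst u)"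

lemma limit_k: "limit_ord k"
  by (rule inaccessible_limit[OF k])

lemma W: "W \<subseteq> S_inc k" "nowhere_stationary k W"
  using diagonal_union_nowhere_stationary[of T k] T by blast+

lemma W_I: "i < d \<Longrightarrow> t \<in> nodes d \<Longrightarrow> d \<in> T i t \<Longrightarrow> d \<in> W"
  unfolding diagonal_union_def by blast

lemma C_sub: "C \<subseteq> ordset k"
  using C(1) unfolding club_in_def by blast

lemma nodes_up: "t \<in> nodes k \<Longrightarrow> fst t < d \<Longrightarrow> t \<in> nodes d"
  by (simp add: nodes_iff)

section \<open>The fusion below a fixed stage\<close>

context
  fixes f i
  assumes stages: "\<And>j. j < i \<Longrightarrow> stage f j (fst (f j)) (snd (f j))"
begin

abbreviation (input) "t j \<equiv> fst (f j)"
abbreviation (input) "u j \<equiv> snd (f j)"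

lemma stageD:
  assumes "j < i"
  shows "j \<le> fst (t j)" "t j \<in> nodes k" "u j \<in> nodes k" "usable j (t j)" "initseg (t j) (u j)"
    "\<exists>c\<in>C. fst (t j) < c \<and> c < fst (u j)" "fst (t j) < fst (u j)"
    "witness k (q j (t j)) (t j) (T j (t j)) (M j (t j))"
  using stages[OF assms] unfolding stage_def usable_def by auto

lemma stage_less:
  assumes "j < j'" "j' < i"
  shows "initseg (u j) (t j')" "initseg (u j) (u j')" "fst (u j) < fst (u j')"
proof -
  show 1: "initseg (u j) (t j')" using stages[OF assms(2)] assms(1) unfolding stage_def by blast
  show "initseg (u j) (u j')" by (rule initseg_trans[OF 1 stageD(5)[OF assms(2)]])
  show "fst (u j) < fst (u j')" using 1 stageD(7)[OF assms(2)] by (auto simp: initseg_def)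
qed

lemma stage_in:
  assumes "j \<le> j'" "j' < i"
  shows "u j' \<in> q j (t j)"
  using stages[OF assms(2)] assms(1) unfolding stage_def by (cases "j = j'") auto

lemma stage_chain:
  assumes "j < i" "j' < i"
  shows "initseg (u j) (u j') \<or> initseg (u j') (u j)"
  using stage_less(2)[of j j'] stage_less(2)[of j' j] assms initseg_refl[OF stageD(3)[OF assms(1)]]
  by (cases j j' rule: linorder_cases) auto

lemma stage_mono: "j \<le> j' \<Longrightarrow> j' < i \<Longrightarrow> fst (u j) \<le> fst (u j')"
  using stage_less(3)[of j j'] by (cases "j = j'") (auto simp: less_le)

lemma stage_union:
  "\<exists>x. (\<forall>j<i. rstr x (fst (u j)) = snd (u j)) \<and> (\<forall>b. (\<forall>j<i. fst (u j) \<le> b) \<longrightarrow> \<not> x b)"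
proof -
  have "initseg (u j) (u j') \<or> initseg (u j') (u j)" if "j \<in> ordset i" "j' \<in> ordset i" for j j'
    using stage_chain that by simp
  moreover have "snd (u j) \<in> seqs (fst (u j))" if "j \<in> ordset i" for j
    using stageD(3)[of j] that by (simp add: nodes_iff)
  ultimately show ?thesis using chain_union[of "ordset i" u] by (simp add: Ball_def)
qed

text \<open>The node \<open>mu\<close> is the union of the nodes \<open>u j\<close>, and regularity
  keeps its length below \<open>k\<close>. If there is a longest \<open>u j\<close>, it equals
  \<open>mu\<close>; otherwise the length is a limit of points of \<open>C\<close>, hence lies in
  \<open>C\<close> and outside \<open>W\<close>, so no earlier condition removes nodes at that
  level.\<close>

lemma stage_limit:
  assumes ik: "i < k"
  shows "\<exists>mu\<in>nodes k. i \<le> fst mu \<and> (\<forall>j<i. initseg (u j) mu \<and> mu \<in> q j (t j))"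
proof -
  obtain x where x: "\<And>j. j < i \<Longrightarrow> rstr x (fst (u j)) = snd (u j)"
    and x0: "\<And>b. (\<forall>j<i. fst (u j) \<le> b) \<Longrightarrow> \<not> x b"
    using stage_union by blast
  have "(\<lambda>j. fst (u j)) ` ordset i \<subseteq> ordset k"
    using stageD(3) by (auto simp: nodes_iff)
  from inaccessible_regular[OF k inaccessible_ordset_less[OF k ik] this]
  obtain b where b: "b < k" "\<forall>j<i. fst (u j) < b" by auto
  \<comment> \<open>The bound is non-strict, so that \<open>g\<close> is attained exactly when a
    longest node exists.\<close>
  define g where "g = (LEAST b. \<forall>j<i. fst (u j) \<le> b)"
  have g: "\<forall>j<i. fst (u j) \<le> g"
    unfolding g_def by (rule LeastI[of _ b]) (use b in auto)
  have "g \<le> b" unfolding g_def by (rule Least_le) (use b in auto)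
  then have gk: "g < k" using b by simp
  have below: "\<exists>j<i. b < fst (u j)" if "b < g" for b
    using not_less_Least[OF that[unfolded g_def]] by (auto simp: not_le)
  define mu where "mu = (g, x)"
  have mu: "mu \<in> nodes k"
    using gk g x0 unfolding mu_def nodes_def seqs_def by (auto intro: order_trans)
  have u_mu: "initseg (u j) mu" if "j < i" for j
    using x[OF that] g that by (auto simp: initseg_def mu_def)
  have ig: "i \<le> g"
  proof (rule ccontr)
    assume "\<not> ?thesis"
    then have "g < i" by simp
    then show False using stageD(1,7)[of g] g by (meson le_less_trans not_less)
  qed
  have "mu \<in> q j (t j)" if j: "j < i" for j
  proof (cases "\<exists>j'<i. fst (u j') = g")
    case True
    then obtain j' where j': "j' < i" "fst (u j') = g" by blast
    then have "mu = u j'"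
      using initseg_same_length[of "u j'" mu k] u_mu[OF j'(1)] mu stageD(3)[OF j'(1)]
      by (auto simp: mu_def)
    moreover have "j \<le> j'" using stage_less(3)[of j' j] j j' g by (meson not_less)
    ultimately show ?thesis using stage_in j' by blast
  next
    case False
    then have u_g: "fst (u j) < g" if "j < i" for j
      using g that by (meson order_le_imp_less_or_eq)
    have g_lim: "limit_ord g" unfolding limit_ord_def using u_g below j by blast
    have "unbounded_in g (C \<inter> ordset g)"
    proof (rule unbounded_inI)
      fix b assume "b < g"
      then obtain j1 where j1: "j1 < i" "b < fst (u j1)" using below by blast
      \<comment> \<open>The element of \<open>C\<close> provided by stage \<open>j2\<close> lies
        above the length of \<open>t j2\<close>, which already extends \<open>u j1\<close>.\<close>
      obtain j2 where j2: "j2 < i" "fst (u j1) < fst (u j2)" using below u_g[OF j1(1)] by blast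
      then have "j1 < j2" using stage_mono[of j2 j1] j1 by (meson not_less)
      then have "fst (u j1) \<le> fst (t j2)"
        using stage_less(1)[of j1 j2] j2 by (simp add: initseg_def)
      moreover obtain c where "c \<in> C" "fst (t j2) < c" "c < fst (u j2)"
        using stageD(6)[OF j2(1)] by blast
      ultimately show "\<exists>c\<in>C \<inter> ordset g. b \<le> c"
        using u_g[OF j2(1)] j1 by (intro bexI[of _ c]) auto
    qed
    then have "g \<in> C" using C(1) gk g_lim unfolding club_in_def by blast
    then have "g \<notin> W" using C(2) by blast
    moreover have "fst (t j) < g" using stageD(7)[OF j] u_g[OF j] by simp
    moreover from this have "j < g" using stageD(1)[OF j] by simp
    ultimately have "g \<notin> T j (t j)"
      using W_I[of j g "t j"] nodes_up[OF stageD(2)[OF j], of g] by blast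
    moreover have "(s, rstr x s) \<in> q j (t j)" if sg: "s < g" for s
    proof -
      obtain j1 where j1: "j1 < i" "s < fst (u j1)" using below[OF sg] by blast
      \<comment> \<open>The node of stage \<open>m\<close> is late enough to belong to the condition
        of stage \<open>j\<close>, and it is longer than \<open>s\<close>.\<close>
      define m where "m = max j j1"
      have m: "m < i" "j \<le> m" "j1 \<le> m" using j j1 by (auto simp: m_def)
      then have s: "s < fst (u m)" using stage_mono[of j1 m] j1 by simp
      then have "rstr (snd (u m)) s = rstr x s" by (simp add: x[OF m(1), symmetric] min.absorb2)
      then show ?thesis
        using witness_rstr[OF stageD(8)[OF j] stage_in[OF m(2,1)], of s] s by simp
    qed
    moreover have "x \<in> seqs g" using mu by (simp add: nodes_iff mu_def)
    ultimately show ?thesis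
      using witnessD(9)[OF stageD(8)[OF j] gk g_lim, of x] unfolding mu_def by blast
  qed
  then show ?thesis using mu ig u_mu by (intro bexI[of _ mu]) (auto simp: mu_def)
qed

text \<open>Predensity of \<open>J i\<close>, applied to the intersection of the earlier conditions,
  yields a trunk \<open>v\<close>. Intersecting them with \<open>q i v\<close> as well and cutting
  at a level \<open>d \<in> A - W\<close> yields a condition of \<open>QQ d\<close>; a branch of it
  in the heavy null set is the new \<open>u\<close>.\<close>

lemma stage_exists:
  assumes ik: "i < k"
  shows "\<exists>r v. stage f i r v"
proof -
  obtain mu where mu: "mu \<in> nodes k" "i \<le> fst mu" "\<And>j. j < i \<Longrightarrow> initseg (u j) mu"
    "\<And>j. j < i \<Longrightarrow> mu \<in> q j (t j)"
    using stage_limit[OF ik] by blast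
  have t_mu: "initseg (t j) mu" if "j < i" for j
    using initseg_trans[OF stageD(5) mu(3)] that by blast
  define p where "p = {eta \<in> nodes k. (initseg mu eta \<or> initseg eta mu) \<and>
    (\<forall>j\<in>ordset i. eta \<in> q j (t j))}"
  have "\<exists>N. witness k p mu {d \<in> W. fst mu < d} N"
    unfolding p_def
  proof (rule witness_Inter[OF limit_k mu(1), where T = "\<lambda>j. T j (t j)" and t = t])
    show "d \<in> W" if "j \<in> ordset i" "d \<in> T j (t j)" "fst mu < d" for j d
    proof (rule W_I[OF _ _ that(2)])
      show "j < d" using that mu(2) by simp
      have "fst (t j) < d" using t_mu[of j] that unfolding initseg_def by (auto intro: le_less_trans)
      then show "t j \<in> nodes d" using nodes_up stageD(2)[of j] that(1) by simp
    qed
    show "|ordset i| \<le>o |ordset d|" if "fst mu < d" for d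
      using that mu(2) by (intro card_of_mono1 ordset_mono) simp
  qed (use stageD(8) t_mu mu W in auto)
  then obtain Np where p: "witness k p mu {d \<in> W. fst mu < d} Np" ..
  then have "p \<in> QQ k" using QQ_iff by blast
  then obtain m r where m: "m \<in> J i" "r \<in> QQ k" "r \<subseteq> p" "r \<subseteq> m"
    using J[OF ik] unfolding predense_def compatible_def by blast
  then obtain v Sr Nr where r: "witness k r v Sr Nr" using QQ_iff by blast
  \<comment> \<open>Only the trunk of \<open>r\<close> is kept. The fixed condition
    \<open>q i v\<close> replaces \<open>r\<close>, since its witnessing set is covered by
    \<open>W\<close> beyond \<open>v\<close>, while \<open>Sr\<close> is not controlled.\<close>
  have use: "usable i v" unfolding usable_def by (rule q[OF m(1,4) r])
  have v: "v \<in> nodes k" "v \<in> p" using witnessD(1,3)[OF r] m(3) by auto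
  \<comment> \<open>Since \<open>r \<subseteq> p\<close>, both successors of \<open>v\<close> are in
    \<open>p\<close>, which places \<open>v\<close> above the trunk \<open>mu\<close> of
    \<open>p\<close>.\<close>
  have "ext v b \<in> r" for b
    by (rule witnessD(4)[OF r witnessD(3)[OF r] initseg_refl[OF v(1)]])
  then have mu_v: "initseg mu v" using witnessD(5)[OF p v(2)] m(3) by blast
  then have len: "i \<le> fst v" using mu(2) by (auto simp: initseg_def)
  \<comment> \<open>The trunks of the earlier stages, together with \<open>v\<close> at stage
    \<open>i\<close>, as one family over the stages up to \<open>i\<close>.\<close>
  define t' where "t' j = (if j < i then t j else v)" for j
  define K where "K = insert i (ordset i)"
  have t'_le: "initseg (t' j) v" for j
    using initseg_trans[OF t_mu mu_v] initseg_refl[OF v(1)] by (simp add: t'_def)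
  have w': "witness k (q j (t' j)) (t' j) (T j (t' j)) (M j (t' j))" if "j \<in> K" for j
    using stageD(8)[of j] use that by (auto simp: t'_def K_def usable_def)
  define p' where "p' = {eta \<in> nodes k. (initseg v eta \<or> initseg eta v) \<and>
    (\<forall>j\<in>K. eta \<in> q j (t' j))}"
  have "\<exists>N. witness k p' v {d \<in> W. fst v < d} N"
    unfolding p'_def
  proof (rule witness_Inter[OF limit_k v(1), where T = "\<lambda>j. T j (t' j)" and t = t'])
    show "v \<in> q j (t' j)" if "j \<in> K" for j
      using that v(2) witnessD(3)[OF w'[OF that]] by (auto simp: K_def t'_def p_def)
    show "d \<in> W" if "j \<in> K" "d \<in> T j (t' j)" "fst v < d" for j d
    proof (rule W_I[OF _ _ that(2)])
      show "j < d" using that len by (auto simp: K_def)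
      have "fst (t' j) < d"
        using t'_le[of j] that(3) unfolding initseg_def by (auto intro: le_less_trans)
      moreover have "t' j \<in> nodes k" using witnessD(1,3)[OF w'[OF that(1)]] by blast
      ultimately show "t' j \<in> nodes d" using nodes_up by blast
    qed
    show "|K| \<le>o |ordset d|" if "fst v < d" for d
      using that len by (intro card_of_mono1) (auto simp: K_def)
  qed (use w' t'_le W in auto)
  then obtain N' where p': "witness k p' v {d \<in> W. fst v < d} N'" ..
  \<comment> \<open>Unboundedness is non-strict; passing to successors makes both inequalities in
    \<open>fst v < c < d\<close> strict.\<close>
  have "osucc (fst v) < k" using osucc_less_limit[OF limit_k] v(1) by (simp add: nodes_iff)
  then obtain c where c: "c \<in> C" "osucc (fst v) \<le> c"
    using C(1) unfolding club_in_def unbounded_in_def by blast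
  have vc: "fst v < c" using osucc_greater[of "fst v" k] v(1) c(2) by (simp add: nodes_iff)
  have "c < k" using c(1) C_sub by auto
  then obtain d where d: "d \<in> A - W" "osucc c \<le> d"
    using A(2) osucc_less_limit[OF limit_k, of c] unfolding unbounded_in_def by blast
  have cd: "c < d" using osucc_greater[OF \<open>c < k\<close>] d(2) by simp
  have d': "d < k" "strongly_inaccessible d" "Pr d"
    using d(1) A(1) by (auto simp: S_pr_def S_inc_def)
  have d_lim: "limit_ord d" by (rule inaccessible_limit[OF d'(2)])
  have "p' \<inter> nodes d \<in> QQ d"
    using witness_restrict[OF p' less_imp_le[OF d'(1)] d_lim order.strict_trans[OF vc cd]] QQ_iff
    by blast
  then obtain h where h: "h \<in> branches d (p' \<inter> nodes d)" "h \<in> heavy_null d"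
    using heavy_null(2)[OF d'(3)] by blast
  \<comment> \<open>As \<open>d \<notin> W\<close>, nothing is removed from \<open>p'\<close> at
    level \<open>d\<close>, so the branch \<open>h\<close> survives as a node.\<close>
  have dh: "(d, h) \<in> p'"
  proof -
    have "h \<in> seqs d" "\<forall>s<d. (s, rstr h s) \<in> p'" using h(1) by (auto simp: branches_def)
    then show ?thesis using witnessD(9)[OF p' d'(1) d_lim, of h] d(1) by blast
  qed
  then have "initseg v (d, h)" using vc cd by (auto simp: p'_def initseg_def[of "(d, h)"])
  moreover have in_q: "(d, h) \<in> q j (t' j)" if "j \<in> K" for j using dh that by (simp add: p'_def)
  have "(d, h) \<in> q i v" using in_q[of i] by (simp add: K_def t'_def)
  moreover have "\<forall>j<i. (d, h) \<in> q j (t j)"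
  proof (intro allI impI)
    fix j assume "j < i"
    then show "(d, h) \<in> q j (t j)" using in_q[of j] by (simp add: K_def t'_def)
  qed
  moreover have "initseg (u j) v" if "j < i" for j by (rule initseg_trans[OF mu(3)[OF that] mu_v])
  moreover have "(d, h) \<in> nodes k" using dh by (simp add: p'_def)
  ultimately have "stage f i v (d, h)"
    unfolding stage_def using len v(1) use d(1) h(2) c(1) vc cd by auto
  then show ?thesis by blast
qed

end

text \<open>The branch is the union of the nodes reached. From stage \<open>i\<close> on they all
  belong to the condition fixed at stage \<open>i\<close>, so the branch runs through a member of
  \<open>J i\<close>; each of them also lies in the heavy null set of a level in \<open>A\<close>,
  and these levels are cofinal in \<open>k\<close>.\<close>

lemma fusion_branch: "\<exists>x\<in>caught k A. \<forall>i<k. x \<notin> set0 k (J i)"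
proof -
  have "\<exists>f. \<forall>i. i < k \<longrightarrow> stage f i (fst (f i)) (snd (f i))"
  \<comment> \<open>\<open>stage f i\<close> looks at \<open>f\<close> only below \<open>i\<close>;
    the guard \<open>i < k\<close> is there because the type may continue past
    \<open>k\<close>.\<close>
  proof (rule dependent_wf_choice[where R = "{(x, y). x < y}" and
        P = "\<lambda>f i r. i < k \<longrightarrow> stage f i (fst r) (snd r)"])
    show "wf {(x::'o, y). x < y}" by (rule wf)
    show "(i < k \<longrightarrow> stage f i (fst r) (snd r)) = (i < k \<longrightarrow> stage g i (fst r) (snd r))"
      if "\<And>j. (j, i) \<in> {(x, y). x < y} \<Longrightarrow> f j = g j" for f g i r
      using that by (simp add: stage_def)
    show "\<exists>r. i < k \<longrightarrow> stage f i (fst r) (snd r)"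
      if "\<And>j. (j, i) \<in> {(x, y). x < y} \<Longrightarrow> j < k \<longrightarrow> stage f j (fst (f j)) (snd (f j))" for i f
    proof (cases "i < k")
      case True
      then have "\<exists>r v. stage f i r v" by (intro stage_exists) (use that in auto)
      then show ?thesis by auto
    qed simp
  qed
  then obtain f where f: "\<And>i. i < k \<Longrightarrow> stage f i (fst (f i)) (snd (f i))" by blast
  obtain x where x: "\<And>j. j < k \<Longrightarrow> rstr x (fst (snd (f j))) = snd (snd (f j))"
    and x0: "\<And>b. (\<forall>j<k. fst (snd (f j)) \<le> b) \<Longrightarrow> \<not> x b"
    using stage_union[OF f] by blast
  have long: "j < fst (snd (f j))" "fst (snd (f j)) < k" if "j < k" for j
    using stageD(1,3,7)[OF f that] by (auto simp: nodes_iff)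
  have xk: "x \<in> seqs k"
    unfolding seqs_def using x0 long(2) by (auto intro: less_imp_le order.strict_trans2)
  have "x \<notin> set0 k (J i)" if i: "i < k" for i
  proof -
    obtain m where m: "m \<in> J i" "q i (fst (f i)) \<subseteq> m"
      using stageD(4)[OF f i] unfolding usable_def by blast
    have "(a, rstr x a) \<in> q i (fst (f i))" if a: "a < k" for a
    proof -
      define j where "j = max i a"
      have j: "j < k" "i \<le> j" "a \<le> fst (snd (f j))"
        using i a long(1)[of j] by (auto simp: j_def)
      have "rstr (snd (snd (f j))) a = rstr x a" using j(3) by (simp add: x[OF j(1), symmetric] min.absorb2)
      then show ?thesis
        using witness_rstr[OF stageD(8)[OF f i] stage_in[OF f j(2,1)] j(3)] by simp
    qed
    then have "x \<in> branches k m" using xk m(2) by (auto simp: branches_def)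
    then show ?thesis using m(1) by (auto simp: set0_def)
  qed
  moreover have "unbounded_in k {d \<in> A. rstr x d \<in> heavy_null d}"
  proof (rule unbounded_inI)
    fix b assume b: "b < k"
    have "fst (snd (f b)) \<in> A" "rstr x (fst (snd (f b))) \<in> heavy_null (fst (snd (f b)))"
      using f[OF b] x[OF b] by (auto simp: stage_def)
    then show "\<exists>c\<in>{d \<in> A. rstr x d \<in> heavy_null d}. b \<le> c"
      using long(1)[OF b] by (intro bexI[of _ "fst (snd (f b))"]) auto
  qed
  ultimately show ?thesis using xk unfolding caught_def by blast
qed

end

text \<open>The other map of the Tukey connection sends \<open>X\<close> to \<open>B\<close>, the
  diagonal union of the witnessing sets cut down to \<open>S_pr k\<close>. If \<open>A\<close> is
  not almost contained in \<open>B\<close>, the fusion produces a point of \<open>caught k A\<close>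
  outside every \<open>set0 k (J i)\<close>, hence outside \<open>X\<close>.\<close>

lemma idQ_caught_bound:
  assumes k: "strongly_inaccessible k" and X: "X \<in> idQ k"
  shows "\<exists>B\<in>nst_pr k. \<forall>A\<in>nst_pr k. caught k A \<subseteq> X \<longrightarrow> subset_star k A B"
proof -
  obtain J where J: "\<And>i. i < k \<Longrightarrow> predense (QQ k) (J i)"
    and X_J: "X \<subseteq> (\<Union>i\<in>ordset k. set0 k (J i))"
    using X unfolding idQ_iff by blast
  define G where "G i t q S N \<longleftrightarrow> witness k q t S N \<and> (\<exists>m\<in>J i. q \<subseteq> m)" for i t q S N
  \<comment> \<open>Nowhere stationarity of \<open>S\<close> is asserted apart from the implication,
    so that it holds at all indices; where no condition exists, \<open>S\<close> is taken
    empty.\<close>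
  have "\<forall>i t. \<exists>q S N. ((\<exists>q S N. G i t q S N) \<longrightarrow> G i t q S N) \<and>
      S \<subseteq> S_inc k \<and> nowhere_stationary k S"
  proof (intro allI, goal_cases)
    case (1 i t)
    show ?case
    proof (cases "\<exists>q S N. G i t q S N")
      case True
      then obtain q S N where G: "G i t q S N" by blast
      then have "witness k q t S N" by (simp add: G_def)
      then show ?thesis
        using G witnessD(6,7)[of k q t S N] by (intro exI[of _ q] exI[of _ S] exI[of _ N]) simp
    next
      case False
      then show ?thesis
        using nowhere_stationary_empty by (intro exI[of _ "{}"] exI[of _ undefined]) simp
    qed
  qed
  then obtain q T M where
    qTM: "\<forall>i t. ((\<exists>q S N. G i t q S N) \<longrightarrow> G i t (q i t) (T i t) (M i t)) \<and>
      T i t \<subseteq> S_inc k \<and> nowhere_stationary k (T i t)"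
    unfolding choice_iff by (elim exE)
  then have q: "G i t r S N \<Longrightarrow> G i t (q i t) (T i t) (M i t)"
    and T: "T i t \<subseteq> S_inc k \<and> nowhere_stationary k (T i t)" for i t r S N
    by blast+
  have W: "nowhere_stationary k (diagonal_union T)"
    by (rule diagonal_union_nowhere_stationary(2)[OF T])
  obtain C where C: "club_in k C" "diagonal_union T \<inter> C = {}"
    using nowhere_stationary_club[OF W order_refl inaccessible_uncountable_cof[OF k]] by blast
  define B where "B = diagonal_union T \<inter> S_pr k"
  have "B \<in> nst_pr k"
    using nowhere_stationary_subset[OF W, of B] by (auto simp: B_def nst_pr_def)
  moreover have "subset_star k A B" if A_nst: "A \<in> nst_pr k" and A_X: "caught k A \<subseteq> X" for A
  proof (rule ccontr)
    assume "\<not> ?thesis"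
    then have "unbounded_in k (A - B)"
      unfolding subset_star_def bounded_in_def unbounded_in_def by (meson not_less)
    moreover have "A - B = A - diagonal_union T"
      using A_nst by (auto simp: B_def nst_pr_def)
    ultimately interpret fusion k J q T M C A
    proof unfold_locales
      show "witness k (q i t) t (T i t) (M i t) \<and> (\<exists>m\<in>J i. q i t \<subseteq> m)"
        if "m \<in> J i" "r \<subseteq> m" "witness k r t S N" for i t m r S N
        using q[of i t r S N] that unfolding G_def by blast
      show "A \<subseteq> S_pr k" using A_nst by (simp add: nst_pr_def)
    qed (use k J T C in simp_all)
    show False using fusion_branch A_X X_J by auto
  qed
  ultimately show ?thesis by blast
qed

text \<open>For each inequality, a family witnessing the larger characteristic is mapped onto one
  witnessing the smaller: by \<open>caught\<close> for additivity and by the map \<open>B\<close> of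
  bounds for cofinality. An image never has more members.\<close>

theorem theorem3p16:
  fixes k :: "'o::wellorder"
  assumes "is_Mahlo k \<or> (strongly_inaccessible k \<and> stationary_in k (S_pr k))"
  shows "(\<forall>F. nst_unbounded_family k F \<longrightarrow>
           (\<exists>A. add_witness (id_minus k) (idQ k) A \<and> (card_of A, card_of F) \<in> ordLeq)) \<and>
         (\<forall>A. cf_witness (id_minus k) (idQ k) A \<longrightarrow>
           (\<exists>C. nst_cofinal_family k C \<and> (card_of C, card_of A) \<in> ordLeq))"
proof -
  have "strongly_inaccessible k" using assms unfolding is_Mahlo_def by blast
  then obtain B where B: "\<And>X. X \<in> idQ k \<Longrightarrow> B X \<in> nst_pr k"
    and caught_B: "\<And>X A. X \<in> idQ k \<Longrightarrow> A \<in> nst_pr k \<Longrightarrow> caught k A \<subseteq> X \<Longrightarrow> subset_star k A (B X)"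
    using idQ_caught_bound[of k] by metis
  show ?thesis
  proof (intro conjI allI impI)
    fix F assume F: "nst_unbounded_family k F"
    have "\<Union>(caught k ` F) \<notin> idQ k"
    proof
      assume X: "\<Union>(caught k ` F) \<in> idQ k"
      have "\<forall>A\<in>F. subset_star k A (B (\<Union>(caught k ` F)))"
        using caught_B[OF X] F unfolding nst_unbounded_family_def by blast
      then show False using B[OF X] F unfolding nst_unbounded_family_def by blast
    qed
    moreover have "caught k ` F \<subseteq> id_minus k"
      using caught_id_minus F unfolding nst_unbounded_family_def by blast
    ultimately have "add_witness (id_minus k) (idQ k) (caught k ` F)"
      by (simp add: add_witness_def)
    then show "\<exists>A. add_witness (id_minus k) (idQ k) A \<and> |A| \<le>o |F|"
      using card_of_image by blast
  next
    fix A assume A: "cf_witness (id_minus k) (idQ k) A"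
    have "\<exists>D\<in>B ` A. subset_star k S D" if S: "S \<in> nst_pr k" for S
      using A caught_id_minus[OF S] caught_B[OF _ S] unfolding cf_witness_def by blast
    moreover have "B ` A \<subseteq> nst_pr k" using A B unfolding cf_witness_def by blast
    ultimately have "nst_cofinal_family k (B ` A)" by (simp add: nst_cofinal_family_def)
    then show "\<exists>C. nst_cofinal_family k C \<and> |C| \<le>o |A|" using card_of_image by blast
  qed
qed

end
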